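(* As power series in $q$ (with $|q|<1$), \begin{align*} \sum_{n=0}^{\infty}\left(N^{0}(0,8;8n+1)-N^{0}(4,8;8n+1) \right)q^n&=\frac{J_{2}^4}{J_{1}^2J_{4}},\\ \sum_{n=0}^{\infty}\left(N^{0}(0,8;8n+3)-N^{0}(4,8;8n+3) \right)q^n&=\frac{J_{4}^3}{J_{2}^2}+qg(q^2;q^4),\\ \sum_{n=0}^{\infty}\left(N^{0}(1,8;8n)-N^{0}(3,8;8n) \right)q^n&=qg(q;q^4),\\ \sum_{n=0}^{\infty}\left(N^{0}(1,8;8n+2)-N^{0}(3,8;8n+2) \right)q^n&=\frac{J_{2}J_{4}}{J_{1}}. \end{align*}
   Context: For $|q|<1$: $(a;q)_n=\prod_{k=0}^{n-1}(1-aq^k)$, $(a;q)_\infty=\prod_{k\ge0}(1-aq^k)$, $J_m=(q^m;q^m)_\infty$, and for $x$ not an integer power of $q$, \[g(x;q)=x^{-1}\Big(-1+\sum_{n=0}^{\infty}\frac{q^{n^2}}{(x;q)_{n+1}(q/x;q)_{n}}\Big).\] An odd Durfee symbol of a positive integer $n$ consists of a nonnegative integer $D$ together with two (possibly empty) non-increasing sequences of odd positive integers $a_1\ge\cdots\ge a_s$ (top row) and $b_1\ge\cdots\ge b_t$ (bottom row), all entries at most $2D+1$, with $n=\sum a_i+\sum b_j+2D^2+2D+1$; its odd rank is $s-t$. $N^{0}(a,M;n)$ is the number of odd Durfee symbols of $n$ with odd rank congruent to $a$ modulo $M$, and $N^0(a,M;0)=0$. *)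

theory Defs
  imports "HOL-Analysis.Analysis" "HOL-Number_Theory.Cong"
begin

definition qpoch :: "complex \<Rightarrow> complex \<Rightarrow> nat \<Rightarrow> complex" where
  "qpoch a q n = (\<Prod>k<n. 1 - a * q ^ k)"

definition qpoch_inf :: "complex \<Rightarrow> complex \<Rightarrow> complex" where
  "qpoch_inf a q = (\<Prod>k. 1 - a * q ^ k)"

definition J :: "nat \<Rightarrow> complex \<Rightarrow> complex" where
  "J m q = qpoch_inf (q ^ m) (q ^ m)"

text \<open>Meaningful for \<open>0 < norm q < 1\<close> and \<open>x\<close> not an integer power of \<open>q\<close>.\<close>

definition g :: "complex \<Rightarrow> complex \<Rightarrow> complex" where
  "g x q = inverse x *
     (- 1 + (\<Sum>n. q ^ (n\<^sup>2) / (qpoch x q (n + 1) * qpoch (q / x) q n)))"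

text \<open>A symbol is a triple of the subscript \<open>D\<close>, the top row and the bottom row.\<close>

definition odd_Durfee_symbols :: "nat \<Rightarrow> (nat \<times> nat list \<times> nat list) set" where
  "odd_Durfee_symbols n =
     {(D, xs, ys).
        sorted_wrt (\<ge>) xs \<and> sorted_wrt (\<ge>) ys \<and>
        (\<forall>x \<in> set xs \<union> set ys. odd x \<and> x \<le> 2 * D + 1) \<and>
        n = sum_list xs + sum_list ys + 2 * D\<^sup>2 + 2 * D + 1}"

fun odd_rank :: "nat \<times> nat list \<times> nat list \<Rightarrow> int" where
  "odd_rank (D, xs, ys) = int (length xs) - int (length ys)"

definition N0 :: "int \<Rightarrow> int \<Rightarrow> nat \<Rightarrow> nat" where
  "N0 a M n = card {S \<in> odd_Durfee_symbols n. [odd_rank S = a] (mod M)}"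

lemma N0_zero: "N0 a M 0 = 0"
  by (simp add: N0_def odd_Durfee_symbols_def)

lemma length_le_sum_list:
  fixes xs :: "nat list"
  assumes "\<forall>x \<in> set xs. odd x"
  shows "length xs \<le> sum_list xs"
  using assms
proof (induction xs)
  case (Cons x xs)
  then show ?case by (cases x) auto
qed simp

lemma finite_odd_Durfee_symbols: "finite (odd_Durfee_symbols n)"
proof (rule finite_subset)
  let ?L = "{xs. set xs \<subseteq> {..n} \<and> length xs \<le> n}"
  show "odd_Durfee_symbols n \<subseteq> {..n} \<times> ?L \<times> ?L"
  proof (clarsimp simp: odd_Durfee_symbols_def, intro conjI subsetI)
    fix D :: nat and xs ys :: "nat list" and x :: nat
    assume *: "\<forall>x\<in>set xs \<union> set ys. odd x \<and> x \<le> Suc (2 * D)"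
    have lx: "length xs \<le> sum_list xs" "length ys \<le> sum_list ys"
      using * by (auto intro: length_le_sum_list)
    then show "length xs \<le> Suc (sum_list xs + sum_list ys + 2 * D\<^sup>2 + 2 * D)"
      "length ys \<le> Suc (sum_list xs + sum_list ys + 2 * D\<^sup>2 + 2 * D)"
      by linarith+
    show "x \<in> {..Suc (sum_list xs + sum_list ys + 2 * D\<^sup>2 + 2 * D)}" if "x \<in> set xs"
      using member_le_sum_list[OF that] by simp
    show "x \<in> {..Suc (sum_list xs + sum_list ys + 2 * D\<^sup>2 + 2 * D)}" if "x \<in> set ys"
      using member_le_sum_list[OF that] by simp
  qed
  show "finite ({..n} \<times> ?L \<times> ?L)"
    by (intro finite_cartesian_product finite_lists_length_le) auto
qed

end

theory Submission
  imports Defs "HOL-Complex_Analysis.Complex_Analysis"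
begin

text \<open>
  By its generating function, the odd rank of odd Durfee symbols is governed by \<open>p g(z p; p\<^sup>2)\<close>, so the
  four series are the sections modulo 8 of \<open>p g(z p; p\<^sup>2)\<close> averaged over the primitive eighth roots of
  unity \<open>z\<close>. The heart of the matter is the bisection
  \<open>(g(x; q) + g(-x; q)) / 2 + q g(-q x\<^sup>2; q\<^sup>4) = C(q) / (theta product in x)\<close>:
  after multiplication by the theta product the left-hand side is holomorphic on the punctured plane
  and invariant under \<open>x \<mapsto> q\<^sup>2 x\<close>, because \<open>g\<close> satisfies \<open>g(q x; q) = - x\<^sup>3 g(x; q) - x - x\<^sup>2\<close>; hence it is
  constant by Liouville's theorem. Applying the bisection twice expresses the average in terms of
  \<open>g\<close> with base \<open>q\<^sup>1\<^sup>6\<close> and of eta quotients, and Ramanujan's \<open>\<phi>(q) = \<phi>(q\<^sup>4) + 2 q \<psi>(q\<^sup>8)\<close>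
  turns these into series in which each exponent class can be read off.
\<close>

subsection \<open>Infinite q-shifted factorials\<close>

text \<open>The generating variable \<open>p\<close> is a square root of the base \<open>q\<close>,
  so the four arguments \<open>z p\<close> form two pairs \<open>x\<close>, \<open>- x\<close> with
  \<open>x^2\<close> equal to \<open>i q\<close> or \<open>- i q\<close>. This is why two bisections
  suffice: \<open>- q x^2\<close> becomes \<open>- i q^2\<close> or \<open>i q^2\<close>, an
  opposite pair for the base \<open>q^4\<close>, and the second bisection lands on a power of
  \<open>q\<close>. The poles of \<open>g\<close> stand in the way of Liouville's theorem. Hence the
  argument runs through \<open>g_num\<close>, a series for \<open>g\<close> times its theta product,
  and \<open>g\<close> returns only where the theta products involved are nonzero. The plain average
  over the roots does not see odd ranks; the classes 1 and 3 need the weight \<open>z^3\<close>. The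
  functional equation absorbs this weight at the price of bisecting at \<open>x q\<close> instead of
  \<open>x\<close>, and exchanging the rows replaces the class 3 by 5, which is the one the weighted
  filter detects. The identities are proved as convergent sums at a nonzero point, because the theta
  shifts divide by it; the origin needs its own small count of symbols.\<close>

lemma convergent_prod_qpoch:
  fixes a q :: complex
  assumes "norm q < 1"
  shows "convergent_prod (\<lambda>k. 1 - a * q ^ k)"
proof -
  have "summable (\<lambda>k. norm a * norm q ^ k)"
    using assms by (intro summable_mult summable_geometric) auto
  then show ?thesis
    by (intro abs_convergent_prod_imp_convergent_prod summable_imp_abs_convergent_prod)
       (simp add: norm_mult norm_power)
qed

lemma qpoch_tendsto:
  assumes "norm q < 1"
  shows "(\<lambda>n. qpoch a q n) \<longlonglongrightarrow> qpoch_inf a q"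
  unfolding qpoch_def qpoch_inf_def
  using convergent_prod_qpoch[OF assms]
  by (intro has_prod_imp_tendsto') (simp add: convergent_prod_has_prod)

lemma qpoch_0 [simp]: "qpoch a q 0 = 1"
  by (simp add: qpoch_def)

lemma qpoch_Suc: "qpoch a q (Suc n) = qpoch a q n * (1 - a * q ^ n)"
  by (simp add: qpoch_def)

lemma qpoch_inf_split:
  assumes "norm q < 1"
  shows "qpoch_inf a q = qpoch a q n * qpoch_inf (a * q ^ n) q"
proof -
  have "(\<lambda>k. 1 - a * q ^ k) has_prod ((\<Prod>k<n. 1 - a * q ^ k) * (\<Prod>k. 1 - a * q ^ (k + n)))"
    by (rule has_prod_ignore_initial_segment') (rule convergent_prod_qpoch[OF assms])
  from has_prod_unique[OF this] show ?thesis
    by (simp add: qpoch_def qpoch_inf_def power_add mult_ac)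
qed

lemma qpoch_inf_rec:
  assumes "norm q < 1"
  shows "qpoch_inf a q = (1 - a) * qpoch_inf (a * q) q"
  using qpoch_inf_split[OF assms, of a 1] by (simp add: qpoch_def)

lemma qpoch_inf_zero_left [simp]: "qpoch_inf 0 q = 1"
  by (simp add: qpoch_inf_def)

lemma qpoch_inf_one [simp]:
  assumes "norm q < 1"
  shows "qpoch_inf 1 q = 0"
  using qpoch_inf_rec[OF assms, of 1] by simp

lemma mult_power_ne_one:
  fixes a q :: complex
  assumes "norm q < 1" "norm a < 1"
  shows "a * q ^ k \<noteq> 1"
proof
  assume "a * q ^ k = 1"
  then have "norm a * norm q ^ k = 1"
    by (metis norm_mult norm_one norm_power)
  moreover have "norm a * norm q ^ k \<le> norm a * 1"
    using assms by (intro mult_left_mono power_le_one) auto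
  ultimately show False using assms by simp
qed

lemma qpoch_nonzero:
  assumes "norm q < 1" "norm a < 1"
  shows "qpoch a q n \<noteq> 0"
  using mult_power_ne_one[OF assms] by (auto simp: qpoch_def)

lemma qpoch_inf_nonzero:
  assumes "norm q < 1" "norm a < 1"
  shows "qpoch_inf a q \<noteq> 0"
  unfolding qpoch_inf_def
  using mult_power_ne_one[OF assms]
  by (intro prodinf_nonzero convergent_prod_qpoch assms) auto

text \<open>Each factor is bounded by \<open>1 + t \<le> exp t\<close>, and the exponents add up to
  a geometric series. The bound depends on \<open>a\<close> only through its norm, which later
  yields uniform majorants for theta terms.\<close>

lemma norm_qpoch_inf_le:
  assumes "norm q < 1"
  shows "norm (qpoch_inf a q) \<le> exp (norm a / (1 - norm q))"
proof (rule LIMSEQ_le_const2)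
  show "(\<lambda>n. norm (qpoch a q n)) \<longlonglongrightarrow> norm (qpoch_inf a q)"
    by (intro tendsto_norm qpoch_tendsto assms)
  have "norm (qpoch a q n) \<le> exp (norm a / (1 - norm q))" for n
  proof -
    have "norm (qpoch a q n) \<le> (\<Prod>k<n. exp (norm a * norm q ^ k))"
      unfolding qpoch_def prod_norm[symmetric]
    proof (rule prod_mono, safe)
      fix k
      have "norm (1 - a * q ^ k) \<le> 1 + norm a * norm q ^ k"
        by (rule order_trans[OF norm_triangle_ineq4]) (simp add: norm_mult norm_power)
      also have "\<dots> \<le> exp (norm a * norm q ^ k)"
        by (rule exp_ge_add_one_self)
      finally show "norm (1 - a * q ^ k) \<le> exp (norm a * norm q ^ k)" .
    qed auto
    also have "\<dots> = exp (norm a * (\<Sum>k<n. norm q ^ k))"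
      by (simp add: exp_sum sum_distrib_left)
    also have "(\<Sum>k<n. norm q ^ k) \<le> (\<Sum>k. norm q ^ k)"
      using assms by (intro sum_le_suminf summable_geometric) auto
    also have "(\<Sum>k. norm q ^ k) = 1 / (1 - norm q)"
      using assms by (intro suminf_geometric) auto
    finally show ?thesis by (simp add: mult_left_mono)
  qed
  then show "\<exists>N. \<forall>n\<ge>N. norm (qpoch a q n) \<le> exp (norm a / (1 - norm q))"
    by blast
qed

lemma holomorphic_qpoch_inf:
  assumes "norm q < 1"
  shows "(\<lambda>a. qpoch_inf a q) holomorphic_on A"
proof (rule holomorphic_on_subset)
  show "(\<lambda>a. qpoch_inf a q) holomorphic_on UNIV"
  proof (rule holomorphic_uniform_sequence[where f = "\<lambda>n a. qpoch a q n"])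
    fix z :: complex
    let ?K = "cball z 1"
    have bound: "norm a \<le> norm z + 1" if "a \<in> ?K" for a
      using that norm_triangle_ineq2[of a z] by (auto simp: dist_norm norm_minus_commute)
    have "uniformly_convergent_on ?K (\<lambda>N a. \<Sum>k<N. norm (- (a * q ^ k)))"
    proof (rule Weierstrass_m_test')
      show "norm (norm (- (a * q ^ n))) \<le> (norm z + 1) * norm q ^ n" if "a \<in> ?K" for n a
        using bound[OF that] by (auto simp: norm_mult norm_power intro!: mult_right_mono)
      show "summable (\<lambda>n. (norm z + 1) * norm q ^ n)"
        using assms by (intro summable_mult summable_geometric) auto
    qed
    then have "uniformly_convergent_on ?K (\<lambda>N a. \<Prod>k<N. 1 + - (a * q ^ k))"
      by (intro Infinite_Products.uniformly_convergent_on_prod) (auto intro!: continuous_intros)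
    then have "uniform_limit ?K (\<lambda>n a. qpoch a q n) (\<lambda>a. lim (\<lambda>n. qpoch a q n)) sequentially"
      by (simp add: uniformly_convergent_uniform_limit_iff qpoch_def)
    moreover have "lim (\<lambda>n. qpoch a q n) = qpoch_inf a q" for a
      using qpoch_tendsto[OF assms] by (rule limI)
    ultimately show "\<exists>d>0. cball z d \<subseteq> UNIV \<and>
        uniform_limit (cball z d) (\<lambda>n a. qpoch a q n) (\<lambda>a. qpoch_inf a q) sequentially"
      by (intro exI[of _ 1]) auto
  qed (auto simp: qpoch_def intro!: holomorphic_intros)
qed auto

lemma holomorphic_on_qpoch_inf_compose [holomorphic_intros]:
  assumes "norm q < 1" "f holomorphic_on A"
  shows "(\<lambda>x. qpoch_inf (f x) q) holomorphic_on A"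
  using holomorphic_on_compose[OF assms(2) holomorphic_qpoch_inf[OF assms(1)]] by (simp add: o_def)

lemma norm_power_less_one:
  fixes q :: complex
  assumes "norm q < 1" "0 < n"
  shows "norm (q ^ n) < 1"
  using assms by (simp add: norm_power power_less_one_iff)

lemma qpoch_inf_mult_minus:
  assumes "norm q < 1"
  shows "qpoch_inf a q * qpoch_inf (- a) q = qpoch_inf (a\<^sup>2) (q\<^sup>2)"
proof -
  have "qpoch a q n * qpoch (- a) q n = qpoch (a\<^sup>2) (q\<^sup>2) n" for n
    by (simp add: qpoch_def flip: prod.distrib)
       (intro prod.cong, auto simp: algebra_simps power2_eq_square power_mult_distrib)
  moreover have "(\<lambda>n. qpoch a q n * qpoch (- a) q n) \<longlonglongrightarrow> qpoch_inf a q * qpoch_inf (- a) q"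
    by (intro tendsto_mult qpoch_tendsto assms)
  moreover have "(\<lambda>n. qpoch (a\<^sup>2) (q\<^sup>2) n) \<longlonglongrightarrow> qpoch_inf (a\<^sup>2) (q\<^sup>2)"
    by (intro qpoch_tendsto norm_power_less_one assms) auto
  ultimately show ?thesis
    by (simp add: LIMSEQ_unique)
qed

lemma qpoch_inf_bisect:
  assumes "norm q < 1"
  shows "qpoch_inf a (q\<^sup>2) * qpoch_inf (a * q) (q\<^sup>2) = qpoch_inf a q"
proof -
  have q2: "norm (q\<^sup>2) < 1"
    using assms by (intro norm_power_less_one) auto
  have "qpoch a (q\<^sup>2) n * qpoch (a * q) (q\<^sup>2) n = qpoch a q (2 * n)" for n
    by (induction n) (auto simp: qpoch_Suc power_mult[symmetric] algebra_simps)
  moreover have "(\<lambda>n. qpoch a (q\<^sup>2) n * qpoch (a * q) (q\<^sup>2) n) \<longlonglongrightarrow>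
      qpoch_inf a (q\<^sup>2) * qpoch_inf (a * q) (q\<^sup>2)"
    by (intro tendsto_mult qpoch_tendsto q2)
  moreover have "(\<lambda>n. qpoch a q (2 * n)) \<longlonglongrightarrow> qpoch_inf a q"
    using LIMSEQ_subseq_LIMSEQ[OF qpoch_tendsto[OF assms], of "\<lambda>n. 2 * n"]
    by (simp add: o_def strict_mono_def)
  ultimately show ?thesis
    by (simp add: LIMSEQ_unique)
qed

section \<open>Euler's power series for the infinite product\<close>

lemma summable_norm_ratio_tendsto_0:
  fixes f s :: "nat \<Rightarrow> complex"
  assumes "s \<longlonglongrightarrow> 0" "\<And>n. f (Suc n) = s n * f n"
  shows "summable (\<lambda>n. norm (f n))"
proof -
  have "\<forall>\<^sub>F n in sequentially. norm (s n) < 1 / 2"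
    using assms(1) by (intro order_tendstoD(2)[OF tendsto_norm_zero]) auto
  then obtain N where N: "\<And>n. n \<ge> N \<Longrightarrow> norm (s n) < 1 / 2"
    by (auto simp: eventually_sequentially)
  show ?thesis
  proof (rule summable_ratio_test[of "1/2" N])
    fix n assume "n \<ge> N"
    then show "norm (norm (f (Suc n))) \<le> 1 / 2 * norm (norm (f n))"
      using mult_right_mono[of "norm (s n)" "1 / 2" "norm (f n)"] N[of n]
      by (simp add: assms(2) norm_mult)
  qed auto
qed

text \<open>The inverses of the partial products converge, since the limit \<open>(q;q)_inf\<close>
  is nonzero, and so they are bounded. This makes the estimates of Durfee terms uniform in both
  indices.\<close>

lemma qpoch_q_bounded_below:
  assumes "norm q < 1"
  obtains m where "m > 0" "\<And>n. m \<le> norm (qpoch q q n)"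
proof -
  have "(\<lambda>n. inverse (qpoch q q n)) \<longlonglongrightarrow> inverse (qpoch_inf q q)"
    by (intro tendsto_inverse qpoch_tendsto qpoch_inf_nonzero assms)
  then have "Bseq (\<lambda>n. inverse (qpoch q q n))"
    by (rule convergent_imp_Bseq[OF convergentI])
  then obtain K where K: "K > 0" "\<And>n. norm (inverse (qpoch q q n)) \<le> K"
    unfolding Bseq_def by blast
  have "inverse K \<le> norm (qpoch q q n)" for n
    using le_imp_inverse_le[OF K(2)[of n]] qpoch_nonzero[OF assms assms, of n]
    by (simp add: norm_inverse)
  with K(1) show ?thesis by (intro that[of "inverse K"]) auto
qed

text \<open>The coefficient of \<open>a ^ n\<close> in Euler's expansion of
  \<open>(a;q)_inf\<close>.\<close>

definition euler_coeff :: "complex \<Rightarrow> nat \<Rightarrow> complex" where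
  "euler_coeff q n = (- 1) ^ n * q ^ (n choose 2) / qpoch q q n"

lemma euler_coeff_Suc:
  assumes "norm q < 1"
  shows "euler_coeff q (Suc n) * (1 - q ^ Suc n) = - (q ^ n) * euler_coeff q n"
  using qpoch_nonzero[OF assms assms, of n] mult_power_ne_one[OF assms assms, of n]
  by (simp add: euler_coeff_def qpoch_Suc numeral_2_eq_2 power_add field_simps)

lemma summable_norm_euler_coeff:
  assumes "norm q < 1"
  shows "summable (\<lambda>n. norm (euler_coeff q n * a ^ n))"
proof (rule summable_norm_ratio_tendsto_0)
  have "(\<lambda>n. q ^ n) \<longlonglongrightarrow> 0"
    using assms by (rule LIMSEQ_power_zero)
  then have "(\<lambda>n. - (q ^ n) * a / (1 - q ^ Suc n)) \<longlonglongrightarrow> - 0 * a / (1 - 0)"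
    using LIMSEQ_Suc[of "\<lambda>n. q ^ n" 0] by (intro tendsto_mult tendsto_divide tendsto_diff tendsto_minus tendsto_const) auto
  then show "(\<lambda>n. - (q ^ n) * a / (1 - q ^ Suc n)) \<longlonglongrightarrow> 0" by simp
next
  fix n
  show "euler_coeff q (Suc n) * a ^ Suc n = - (q ^ n) * a / (1 - q ^ Suc n) * (euler_coeff q n * a ^ n)"
    using arg_cong[OF euler_coeff_Suc[OF assms, of n], of "\<lambda>t. t * a ^ Suc n"]
      mult_power_ne_one[OF assms assms, of n]
    by (simp add: field_simps)
qed

text \<open>Series and product both satisfy \<open>F a = (1 - a) * F (a * q)\<close>. Iterating
  drives the argument to 0, where the series is continuous with value 1.\<close>

theorem euler_sums_qpoch_inf:
  assumes "norm q < 1"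
  shows "(\<lambda>n. euler_coeff q n * a ^ n) sums qpoch_inf a q"
proof -
  define F where "F = (\<lambda>a. \<Sum>n. euler_coeff q n * a ^ n)"
  have summ: "summable (\<lambda>n. euler_coeff q n * a ^ n)" for a
    using summable_norm_euler_coeff[OF assms] by (rule summable_norm_cancel)
  have rec: "F a = (1 - a) * F (a * q)" for a
  proof -
    have "F a - F (a * q) = (\<Sum>n. euler_coeff q n * a ^ n - euler_coeff q n * (a * q) ^ n)"
      unfolding F_def by (rule suminf_diff) (rule summ)+
    also have "\<dots> = (\<Sum>n. euler_coeff q (Suc n) * a ^ Suc n - euler_coeff q (Suc n) * (a * q) ^ Suc n)"
      by (subst suminf_split_head) (auto intro!: summable_diff summ)
    also have "\<dots> = (\<Sum>n. - a * (euler_coeff q n * (a * q) ^ n))"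
    proof (rule suminf_cong)
      fix n
      have "euler_coeff q (Suc n) * a ^ Suc n - euler_coeff q (Suc n) * (a * q) ^ Suc n
        = a ^ Suc n * (euler_coeff q (Suc n) * (1 - q ^ Suc n))"
        by (simp add: algebra_simps power_mult_distrib)
      then show "euler_coeff q (Suc n) * a ^ Suc n - euler_coeff q (Suc n) * (a * q) ^ Suc n
        = - a * (euler_coeff q n * (a * q) ^ n)"
        unfolding euler_coeff_Suc[OF assms] by (simp add: algebra_simps power_mult_distrib)
    qed
    also have "\<dots> = - a * F (a * q)"
      unfolding F_def by (rule suminf_mult) (rule summ)
    finally show ?thesis by (simp add: algebra_simps)
  qed
  have iter: "F a = qpoch a q n * F (a * q ^ n)" for n
    by (induction n) (auto simp: qpoch_Suc rec[of "a * q ^ _"] mult_ac)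
  have "isCont F 0"
    unfolding F_def by (rule isCont_powser[where K = 1]) (use summ[of 1] in auto)
  moreover have "(\<lambda>n. a * q ^ n) \<longlonglongrightarrow> a * 0"
    using assms by (intro tendsto_intros LIMSEQ_power_zero)
  ultimately have "(\<lambda>n. F (a * q ^ n)) \<longlonglongrightarrow> F 0"
    by (metis isCont_tendsto_compose mult_zero_right)
  moreover have "F 0 = 1"
    unfolding F_def powser_zero by (simp add: euler_coeff_def numeral_2_eq_2)
  ultimately have "(\<lambda>n. qpoch a q n * F (a * q ^ n)) \<longlonglongrightarrow> qpoch_inf a q * 1"
    by (intro tendsto_mult qpoch_tendsto assms) auto
  then have "F a = qpoch_inf a q"
    by (simp add: iter[symmetric] LIMSEQ_const_iff)
  with summable_sums[OF summ[of a]] show ?thesis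
    by (simp only: F_def)
qed

subsection \<open>Durfee rectangles and the Jacobi triple product\<close>

text \<open>The generating function of the partitions whose largest rectangle of shape
  \<open>n\<close> by \<open>n + m\<close> has that size; summed over \<open>n\<close> it should
  give all partitions, whatever \<open>m\<close> is.\<close>

definition durfee_term :: "complex \<Rightarrow> nat \<Rightarrow> nat \<Rightarrow> complex" where
  "durfee_term q m n = q ^ (n\<^sup>2 + n * m) / (qpoch q q n * qpoch q q (n + m))"

lemma durfee_term_bound:
  assumes "norm q < 1"
  obtains C where "\<And>m n. norm (durfee_term q m n) \<le> C * norm q ^ n"
proof -
  obtain \<mu> where \<mu>: "\<mu> > 0" "\<And>n. \<mu> \<le> norm (qpoch q q n)"
    using qpoch_q_bounded_below[OF assms] by blast
  have "norm (durfee_term q m n) \<le> inverse (\<mu> * \<mu>) * norm q ^ n" for m n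
  proof -
    have "n \<le> n\<^sup>2 + n * m"
      by (cases n) (auto simp: power2_eq_square)
    then have "norm q ^ (n\<^sup>2 + n * m) \<le> norm q ^ n"
      using assms by (intro power_decreasing) auto
    moreover have "\<mu> * \<mu> \<le> norm (qpoch q q n) * norm (qpoch q q (n + m))"
      using \<mu> by (intro mult_mono) (auto intro: less_imp_le)
    ultimately have "norm q ^ (n\<^sup>2 + n * m) / (norm (qpoch q q n) * norm (qpoch q q (n + m)))
        \<le> norm q ^ n / (\<mu> * \<mu>)"
      using \<mu>(1) by (intro frac_le) auto
    then show ?thesis
      by (simp add: durfee_term_def norm_divide norm_mult norm_power field_simps)
  qed
  then show ?thesis by (rule that)
qed

lemma summable_norm_durfee_term:
  assumes "norm q < 1"
  shows "summable (\<lambda>n. norm (durfee_term q m n))"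
proof -
  obtain C where C: "\<And>m n. norm (durfee_term q m n) \<le> C * norm q ^ n"
    using durfee_term_bound[OF assms] by blast
  show ?thesis
    by (rule summable_comparison_test'[where g = "\<lambda>n. C * norm q ^ n"])
       (use assms C in \<open>auto intro!: summable_mult summable_geometric\<close>)
qed

text \<open>The termwise difference telescopes: it is \<open>w (Suc n) - w n\<close>, where the
  factor \<open>1 - q ^ n\<close> makes \<open>w\<close> vanish at 0 and the summability of the
  Durfee terms makes it vanish in the limit.\<close>

lemma suminf_durfee_term_Suc:
  assumes "norm q < 1"
  shows "(\<Sum>n. durfee_term q (Suc m) n) = (\<Sum>n. durfee_term q m n)"
proof -
  define w where "w = (\<lambda>n. durfee_term q m n * (1 - q ^ n))"
  have "summable (durfee_term q m)" for m
    using summable_norm_durfee_term[OF assms] by (rule summable_norm_cancel)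
  note summ = this
  have "durfee_term q (Suc m) n - durfee_term q m n = w (Suc n) - w n" for n
  proof -
    define A where "A = qpoch q q n"
    define B where "B = qpoch q q (n + m)"
    have nz: "A \<noteq> 0" "B \<noteq> 0" "1 - q * q ^ n \<noteq> 0" "1 - q * q ^ (n + m) \<noteq> 0"
      using qpoch_nonzero[OF assms assms] mult_power_ne_one[OF assms assms]
      by (auto simp: A_def B_def)
    have e: "(Suc n)\<^sup>2 + Suc n * m = (n\<^sup>2 + n * m) + (n + (n + m) + 1)"
      "n\<^sup>2 + n * Suc m = (n\<^sup>2 + n * m) + n"
      by (auto simp: power2_eq_square)
    have t: "durfee_term q (Suc m) n = q ^ (n\<^sup>2 + n * m) * q ^ n / (A * (B * (1 - q * q ^ (n + m))))"
      "w n = q ^ (n\<^sup>2 + n * m) / (A * B) * (1 - q ^ n)"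
      "w (Suc n) = q ^ (n\<^sup>2 + n * m) * (q ^ n * q ^ (n + m) * q) /
        (A * (1 - q * q ^ n) * (B * (1 - q * q ^ (n + m)))) * (1 - q * q ^ n)"
      "durfee_term q m n = q ^ (n\<^sup>2 + n * m) / (A * B)"
      unfolding durfee_term_def w_def e by (simp_all add: qpoch_Suc A_def B_def power_add)
    show ?thesis unfolding t using nz
      by (simp add: divide_simps) (simp add: algebra_simps)
  qed
  moreover have "w \<longlonglongrightarrow> 0"
  proof -
    have "w \<longlonglongrightarrow> 0 * (1 - 0)"
      unfolding w_def using assms
      by (intro tendsto_mult tendsto_diff tendsto_const summable_LIMSEQ_zero summ LIMSEQ_power_zero)
    then show ?thesis by simp
  qed
  ultimately have "(\<lambda>n. durfee_term q (Suc m) n - durfee_term q m n) sums (0 - w 0)"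
    using telescope_sums[of w 0] by simp
  then have "(\<lambda>n. durfee_term q (Suc m) n - durfee_term q m n) sums 0"
    by (simp add: w_def)
  moreover have "(\<lambda>n. durfee_term q (Suc m) n - durfee_term q m n) sums
      ((\<Sum>n. durfee_term q (Suc m) n) - (\<Sum>n. durfee_term q m n))"
    by (intro sums_diff summable_sums summ)
  ultimately show ?thesis
    using sums_unique2 by fastforce
qed

text \<open>Being independent of \<open>m\<close>, the sum may be evaluated as \<open>m\<close>
  tends to infinity, where only the term \<open>n = 0\<close> survives. Tannery's theorem applies
  because the geometric majorant is uniform in \<open>m\<close>.\<close>

lemma durfee_sums:
  assumes "norm q < 1"
  shows "durfee_term q m sums (1 / qpoch_inf q q)"
proof -
  obtain C where C: "\<And>m n. norm (durfee_term q m n) \<le> C * norm q ^ n"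
    using durfee_term_bound[OF assms] by blast
  define b where "b = (\<lambda>n. if n = (0::nat) then 1 / qpoch_inf q q else 0)"
  have lim: "(\<lambda>m. durfee_term q m n) \<longlonglongrightarrow> b n" for n
  proof -
    have P: "(\<lambda>m. qpoch q q (n + m)) \<longlonglongrightarrow> qpoch_inf q q"
      using LIMSEQ_ignore_initial_segment[OF qpoch_tendsto[OF assms], of q n] by (simp add: add.commute)
    have Q: "(\<lambda>m. (q ^ n) ^ m) \<longlonglongrightarrow> (if n = 0 then 1 else 0)"
      using norm_power_less_one[OF assms, of n] by (auto intro!: LIMSEQ_power_zero)
    have "(\<lambda>m. q ^ n\<^sup>2 * (q ^ n) ^ m / (qpoch q q n * qpoch q q (n + m))) \<longlonglongrightarrow>
        q ^ n\<^sup>2 * (if n = 0 then 1 else 0) / (qpoch q q n * qpoch_inf q q)"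
      using qpoch_inf_nonzero[OF assms assms] qpoch_nonzero[OF assms assms]
      by (intro tendsto_divide tendsto_mult tendsto_const P Q) auto
    then show ?thesis
      by (simp add: durfee_term_def b_def power_add power_mult split: if_splits)
  qed
  have "(\<lambda>m. \<Sum>n. durfee_term q m n) \<longlonglongrightarrow> suminf b"
    using tannerys_theorem[of "\<lambda>n m. durfee_term q m n" b sequentially "\<lambda>n. C * norm q ^ n"]
      lim C assms by (auto intro!: always_eventually summable_mult summable_geometric)
  moreover have const: "(\<lambda>m. \<Sum>n. durfee_term q m n) = (\<lambda>_. \<Sum>n. durfee_term q m n)"
  proof -
    have "(\<Sum>n. durfee_term q m n) = (\<Sum>n. durfee_term q 0 n)" for m
      by (induction m) (simp_all add: suminf_durfee_term_Suc[OF assms])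
    then show ?thesis by metis
  qed
  ultimately have "(\<Sum>n. durfee_term q m n) = suminf b"
    by (metis LIMSEQ_const_iff)
  also have "suminf b = 1 / qpoch_inf q q"
    using sums_single[of 0 "\<lambda>_. 1 / qpoch_inf q q"] by (simp add: b_def sums_iff eq_commute)
  finally show ?thesis
    using summable_sums[OF summable_norm_cancel[OF summable_norm_durfee_term[OF assms]], of m] by simp
qed

lemma has_sum_product:
  fixes f g :: "_ \<Rightarrow> complex"
  assumes "(f has_sum a) A" "(g has_sum b) B"
  shows "((\<lambda>(x, y). f x * g y) has_sum (a * b)) (A \<times> B)"
proof (rule has_sum_SigmaI)
  show "((\<lambda>y. (case (x, y) of (x, y) \<Rightarrow> f x * g y)) has_sum f x * b) B" for x
    using assms(2) by (auto intro: has_sum_cmult_right)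
  show "((\<lambda>x. f x * b) has_sum a * b) A"
    using assms(1) by (rule has_sum_cmult_left)
  have f: "(\<lambda>x. norm (f x)) summable_on A" and g: "(\<lambda>y. norm (g y)) summable_on B"
    using assms has_sum_imp_summable summable_on_iff_abs_summable_on_complex by blast+
  have "(\<lambda>z. norm (case z of (x, y) \<Rightarrow> f x * g y)) summable_on (A \<times> B)"
  proof (rule summable_on_SigmaI)
    show "((\<lambda>y. norm (case (x, y) of (x, y) \<Rightarrow> f x * g y)) has_sum
        norm (f x) * (\<Sum>\<^sub>\<infinity>y\<in>B. norm (g y))) B" for x
      using has_sum_cmult_right[OF has_sum_infsum[OF g], of "norm (f x)"] by (simp add: norm_mult)
    show "(\<lambda>x. norm (f x) * (\<Sum>\<^sub>\<infinity>y\<in>B. norm (g y))) summable_on A"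
      using f by (rule summable_on_cmult_left)
  qed auto
  then show "(\<lambda>(x, y). f x * g y) summable_on A \<times> B"
    by (rule abs_summable_summable)
qed

lemma has_sum_theta_half:
  assumes "norm q < 1"
  shows "((\<lambda>n. q ^ n\<^sup>2 * x ^ n / qpoch (q\<^sup>2) (q\<^sup>2) n) has_sum qpoch_inf (- x * q) (q\<^sup>2)) UNIV"
proof -
  have q2: "norm (q\<^sup>2) < 1"
    using assms by (intro norm_power_less_one) auto
  have "euler_coeff (q\<^sup>2) n * (- x * q) ^ n = q ^ n\<^sup>2 * x ^ n / qpoch (q\<^sup>2) (q\<^sup>2) n" for n
  proof -
    have "2 * (n choose 2) + n = n\<^sup>2"
      by (simp add: choose_two power2_eq_square) (cases n, auto)
    then have "q ^ n\<^sup>2 = (q\<^sup>2) ^ (n choose 2) * q ^ n"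
      by (metis power_add power_mult)
    then show ?thesis
      by (simp add: euler_coeff_def power_mult_distrib power_minus[of "q * x"] mult_ac)
  qed
  with norm_summable_imp_has_sum[OF summable_norm_euler_coeff[OF q2] euler_sums_qpoch_inf[OF q2], of "- x * q"]
  show ?thesis by simp
qed

text \<open>The product of the two Euler expansions, collected by the exponent \<open>m\<close> of \<open>x\<close>; the
  coefficient of \<open>x ^ m\<close> is a Durfee rectangle sum.\<close>

theorem jacobi_triple_product:
  assumes q: "norm q < 1" and x: "x \<noteq> 0"
  shows "((\<lambda>m::int. q ^ nat (m\<^sup>2) * x powi m) has_sum
    (qpoch_inf (- x * q) (q\<^sup>2) * qpoch_inf (- q / x) (q\<^sup>2) * qpoch_inf (q\<^sup>2) (q\<^sup>2))) UNIV"
proof -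
  have q2: "norm (q\<^sup>2) < 1"
    using q by (intro norm_power_less_one) auto
  define P where "P = qpoch_inf (q\<^sup>2) (q\<^sup>2)"
  define V where "V = qpoch_inf (- x * q) (q\<^sup>2) * qpoch_inf (- q / x) (q\<^sup>2)"
  have P: "P \<noteq> 0"
    unfolding P_def by (rule qpoch_inf_nonzero[OF q2 q2])
  define T where "T = (\<lambda>(a, b). q ^ a\<^sup>2 * x ^ a / qpoch (q\<^sup>2) (q\<^sup>2) a *
      (q ^ b\<^sup>2 * inverse x ^ b / qpoch (q\<^sup>2) (q\<^sup>2) b))"
  have T: "(T has_sum V) (UNIV \<times> UNIV)"
    unfolding T_def V_def
    using has_sum_product[OF has_sum_theta_half[OF q, of x] has_sum_theta_half[OF q, of "inverse x"]]
    by (simp add: field_simps)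
  \<comment> \<open>A pair of exponents \<open>(a, b)\<close> is encoded by its difference
    \<open>m = a - b\<close>, the total exponent of \<open>x\<close>, and its smaller entry
    \<open>n\<close>.\<close>
  define j where "j = (\<lambda>(m::int, n::nat). (n + nat m, n + nat (- m)))"
  have "((\<lambda>y. T (j y)) has_sum V) (UNIV \<times> UNIV)"
    by (subst has_sum_reindex_bij_witness[where j = j and h = T and T = "UNIV \<times> UNIV" and s' = V
          and i = "\<lambda>(a, b). (int a - int b, min a b)"])
       (use T in \<open>auto simp: j_def\<close>)
  moreover have "((\<lambda>n. T (j (m, n))) has_sum (q ^ nat (m\<^sup>2) * x powi m / P)) UNIV" for m
  proof -
    define k where "k = nat \<bar>m\<bar>"
    have m2: "nat (m\<^sup>2) = k\<^sup>2"
    proof -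
      have "m\<^sup>2 = int (k\<^sup>2)"
        by (simp add: k_def)
      then show ?thesis by linarith
    qed
    have e: "n\<^sup>2 + (n + k)\<^sup>2 = k\<^sup>2 + 2 * (n\<^sup>2 + n * k)" for n
      by (simp add: power2_eq_square algebra_simps)
    have "T (j (m, n)) = q ^ nat (m\<^sup>2) * x powi m * durfee_term (q\<^sup>2) k n" for n
    proof (cases "m \<ge> 0")
      case True
      then have "T (j (m, n)) = q ^ (n\<^sup>2 + (n + k)\<^sup>2) * x powi m /
          (qpoch (q\<^sup>2) (q\<^sup>2) n * qpoch (q\<^sup>2) (q\<^sup>2) (n + k))"
        using x by (simp add: T_def j_def k_def power_add field_simps power_int_def)
      then show ?thesis
        unfolding e m2 by (simp add: durfee_term_def power_add power_mult)
    next
      case False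
      then have "T (j (m, n)) = q ^ (n\<^sup>2 + (n + k)\<^sup>2) * x powi m /
          (qpoch (q\<^sup>2) (q\<^sup>2) n * qpoch (q\<^sup>2) (q\<^sup>2) (n + k))"
        using x by (simp add: T_def j_def k_def power_add field_simps power_int_def)
      then show ?thesis
        unfolding e m2 by (simp add: durfee_term_def power_add power_mult)
    qed
    moreover have "(durfee_term (q\<^sup>2) k has_sum (1 / P)) UNIV"
      unfolding P_def
      by (rule norm_summable_imp_has_sum[OF summable_norm_durfee_term[OF q2] durfee_sums[OF q2]])
    then have "((\<lambda>n. q ^ nat (m\<^sup>2) * x powi m * durfee_term (q\<^sup>2) k n) has_sum
        (q ^ nat (m\<^sup>2) * x powi m * (1 / P))) UNIV"
      by (rule has_sum_cmult_right)
    ultimately show ?thesis by simp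
  qed
  ultimately have "((\<lambda>m. q ^ nat (m\<^sup>2) * x powi m / P) has_sum V) UNIV"
    by (rule has_sum_SigmaD)
  then have "((\<lambda>m. q ^ nat (m\<^sup>2) * x powi m / P * P) has_sum V * P) UNIV"
    by (rule has_sum_cmult_left)
  with P show ?thesis by (simp add: V_def P_def)
qed

section \<open>Eta quotients and the dissection of the theta function phi\<close>

lemma J_nonzero:
  assumes "norm q < 1" "0 < k"
  shows "J k q \<noteq> 0"
  unfolding J_def using norm_power_less_one[OF assms] by (intro qpoch_inf_nonzero)

lemma J_power: "J k (q ^ l) = J (l * k) q"
  by (simp add: J_def power_mult)

lemma qpoch_inf_minus_J:
  assumes "norm q < 1" "0 < k"
  shows "qpoch_inf (- (q ^ k)) (q ^ k) = J (2 * k) q / J k q"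
  using qpoch_inf_mult_minus[OF norm_power_less_one[OF assms], of "q ^ k"] J_nonzero[OF assms]
  by (simp add: J_def field_simps power_mult[symmetric] mult.commute)

lemma qpoch_inf_odd_J:
  assumes "norm q < 1" "0 < k"
  shows "qpoch_inf (q ^ k) (q ^ (2 * k)) = J k q / J (2 * k) q"
  using qpoch_inf_bisect[OF norm_power_less_one[OF assms], of "q ^ k"] J_nonzero[of q "2 * k"] assms
  by (simp add: J_def field_simps power_mult[symmetric] mult.commute mult_2_right power_add[symmetric])

lemma qpoch_inf_minus_odd_J:
  assumes "norm q < 1" "0 < k"
  shows "qpoch_inf (- (q ^ k)) (q ^ (2 * k)) = J (2 * k) q ^ 2 / (J k q * J (4 * k) q)"
proof -
  have "qpoch_inf (- (q ^ k)) (q ^ (2 * k)) * qpoch_inf (- (q ^ (2 * k))) (q ^ (2 * k))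
      = qpoch_inf (- (q ^ k)) (q ^ k)"
    using qpoch_inf_bisect[OF norm_power_less_one[OF assms], of "- (q ^ k)"]
    by (simp add: power_mult[symmetric] mult.commute mult_2_right power_add[symmetric])
  then show ?thesis
    using assms J_nonzero[of q k] J_nonzero[of q "2 * k"] J_nonzero[of q "4 * k"]
    by (simp add: qpoch_inf_minus_J field_simps power2_eq_square)
qed

text \<open>This is \<open>\<phi>(q) = \<phi>(q\<^sup>4) + 2 q \<psi>(q\<^sup>8)\<close> for Ramanujan's theta functions.\<close>

lemma phi_bisection:
  assumes q: "norm q < 1" and q0: "q \<noteq> 0"
  shows "J 2 q ^ 5 / (J 1 q ^ 2 * J 4 q ^ 2) =
    J 8 q ^ 5 / (J 4 q ^ 2 * J 16 q ^ 2) + 2 * q * J 16 q ^ 2 / J 8 q"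
proof -
  have q4: "norm (q ^ 4) < 1" and q8: "norm (q ^ 8) < 1"
    using q by (auto intro: norm_power_less_one)
  note nz = J_nonzero[OF q]
  let ?\<phi> = "\<lambda>m::int. q ^ nat (m\<^sup>2)"
  have m1: "qpoch_inf (- q) (q\<^sup>2) = J 2 q ^ 2 / (J 1 q * J 4 q)"
    "qpoch_inf (- (q ^ 4)) (q ^ 8) = J 8 q ^ 2 / (J 4 q * J 16 q)"
    "qpoch_inf (- (q ^ 8)) (q ^ 8) = J 16 q / J 8 q"
    using qpoch_inf_minus_odd_J[OF q, of 1] qpoch_inf_minus_odd_J[OF q, of 4]
      qpoch_inf_minus_J[OF q, of 8] by simp_all
  \<comment> \<open>The first factor \<open>1 - (- 1)\<close> of this product is the origin of the 2
    in front of the odd part.\<close>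
  have m2: "qpoch_inf (- 1) (q ^ 8) = 2 * (J 16 q / J 8 q)"
    using qpoch_inf_rec[OF q8, of "-1"] m1(3) by simp
  have J: "qpoch_inf (q\<^sup>2) (q\<^sup>2) = J 2 q" "qpoch_inf (q ^ 8) (q ^ 8) = J 8 q"
    by (simp_all add: J_def)
  have frac: "(b\<^sup>2 / (a * c)) * (b\<^sup>2 / (a * c)) * b = b ^ 5 / (a\<^sup>2 * c\<^sup>2)" for a b c :: complex
    by (simp add: eval_nat_numeral mult_ac)
  have full: "(?\<phi> has_sum (J 2 q ^ 5 / (J 1 q ^ 2 * J 4 q ^ 2))) UNIV"
    using jacobi_triple_product[OF q, of 1] by (simp add: m1 J flip: frac)
  have "((\<lambda>m::int. (q ^ 4) ^ nat (m\<^sup>2)) has_sum (J 8 q ^ 5 / (J 4 q ^ 2 * J 16 q ^ 2))) UNIV"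
    using jacobi_triple_product[OF q4, of 1] by (simp add: m1 J power_mult[symmetric] flip: frac)
  moreover have "bij_betw (\<lambda>m::int. 2 * m) UNIV {m. even m}"
    by (rule bij_betwI[where g = "\<lambda>m. m div 2"]) auto
  moreover have "(q ^ 4) ^ nat (m\<^sup>2) = ?\<phi> (2 * m)" for m :: int
    by (simp add: power_mult[symmetric] nat_mult_distrib power_mult_distrib)
  ultimately have ev: "(?\<phi> has_sum (J 8 q ^ 5 / (J 4 q ^ 2 * J 16 q ^ 2))) {m. even m}"
    using has_sum_reindex_bij_betw[of "\<lambda>m::int. 2 * m" UNIV "{m. even m}" ?\<phi>] by simp
  \<comment> \<open>Since \<open>(2 * m + 1)^2 = 1 + 4 * m^2 + 4 * m\<close>, the odd squares form a
    triple product with base \<open>q ^ 4\<close>, evaluated at \<open>x = q ^ 4\<close>.\<close>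
  have "((\<lambda>m::int. q * ((q ^ 4) ^ nat (m\<^sup>2) * (q ^ 4) powi m)) has_sum (q * (2 * J 16 q ^ 2 / J 8 q))) UNIV"
  proof -
    have "- (q ^ 4) * q ^ 4 = - (q ^ 8)" "- (q ^ 4) / q ^ 4 = - 1" "(q ^ 4)\<^sup>2 = q ^ 8"
      using q0 by (simp_all add: power_add[symmetric] power_mult[symmetric])
    then have "((\<lambda>m::int. q * ((q ^ 4) ^ nat (m\<^sup>2) * (q ^ 4) powi m)) has_sum
        (q * (J 16 q / J 8 q * (2 * (J 16 q / J 8 q)) * J 8 q))) UNIV"
      using has_sum_cmult_right[OF jacobi_triple_product[OF q4, of "q ^ 4"], of q] q0
      by (simp only: m1 m2 J) simp
    moreover have "J 16 q / J 8 q * (2 * (J 16 q / J 8 q)) * J 8 q = 2 * J 16 q ^ 2 / J 8 q"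
      using nz[of 8] by (simp add: field_simps power2_eq_square)
    ultimately show ?thesis by simp
  qed
  moreover have "bij_betw (\<lambda>m::int. 2 * m + 1) UNIV {m. odd m}"
    by (rule bij_betwI[where g = "\<lambda>m. m div 2"]) auto
  moreover have "q * ((q ^ 4) ^ nat (m\<^sup>2) * (q ^ 4) powi m) = ?\<phi> (2 * m + 1)" for m :: int
  proof -
    have "q * ((q ^ 4) ^ nat (m\<^sup>2) * (q ^ 4) powi m) = q powi 1 * (q powi (4 * m\<^sup>2) * q powi (4 * m))"
      by (simp add: power_int_mult power_int_def[of _ "m\<^sup>2"])
    also have "\<dots> = q powi (1 + (4 * m\<^sup>2 + 4 * m))"
      by (simp add: power_int_add[OF disjI1[OF q0]])
    also have "1 + (4 * m\<^sup>2 + 4 * m) = (2 * m + 1)\<^sup>2"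
      by (simp add: power2_eq_square algebra_simps)
    finally show ?thesis by (simp add: power_int_def)
  qed
  ultimately have od: "(?\<phi> has_sum (q * (2 * J 16 q ^ 2 / J 8 q))) {m. odd m}"
    using has_sum_reindex_bij_betw[of "\<lambda>m::int. 2 * m + 1" UNIV "{m. odd m}" ?\<phi>] by simp
  have "(?\<phi> has_sum (J 8 q ^ 5 / (J 4 q ^ 2 * J 16 q ^ 2) + q * (2 * J 16 q ^ 2 / J 8 q)))
      ({m. even m} \<union> {m. odd m})"
    by (rule has_sum_Un_disjoint[OF ev od]) auto
  also have "{m::int. even m} \<union> {m. odd m} = UNIV" by auto
  finally show ?thesis
    using has_sum_unique[OF full] by (simp add: algebra_simps)
qed

subsection \<open>Bisection of the universal mock theta function\<close>

text \<open>Jacobi's theta function without the factor \<open>(q;q)_inf\<close>; for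
  \<open>0 < norm q < 1\<close> its zeros are the integer powers of \<open>q\<close>.\<close>

definition theta_prod :: "complex \<Rightarrow> complex \<Rightarrow> complex" where
  "theta_prod x q = qpoch_inf x q * qpoch_inf (q / x) q"

text \<open>This is \<open>theta_prod x q\<close> times the symmetric series with terms
  \<open>q^(n(n+1)) / ((x;q)_(n+1) (q/x;q)_(n+1))\<close>, the denominators being cancelled so that
  no term has a pole away from 0. The symmetric series equals \<open>g\<close> without the
  correction \<open>- 1\<close> and the prefactor, and it makes the invariance under
  \<open>x \<mapsto> q / x\<close> visible.\<close>

definition g_num :: "complex \<Rightarrow> complex \<Rightarrow> complex" where
  "g_num x q = (\<Sum>n. q ^ (n * (n + 1)) * qpoch_inf (x * q ^ (n + 1)) q * qpoch_inf (q ^ (n + 2) / x) q)"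

lemma theta_prod_shift:
  assumes "norm q < 1" "q \<noteq> 0" "x \<noteq> 0"
  shows "theta_prod (x * q) q = - theta_prod x q / x"
proof -
  have e: "q / (x * q) = inverse x" "inverse x * q = q / x"
    using assms by (simp_all add: field_simps)
  have "theta_prod (x * q) q = qpoch_inf (x * q) q * ((1 - inverse x) * qpoch_inf (q / x) q)"
    using qpoch_inf_rec[OF assms(1), of "inverse x"] by (simp add: theta_prod_def e)
  also have "\<dots> = - ((1 - x) * qpoch_inf (x * q) q * qpoch_inf (q / x) q) / x"
    using assms by (simp add: field_simps)
  also have "(1 - x) * qpoch_inf (x * q) q * qpoch_inf (q / x) q = theta_prod x q"
    using qpoch_inf_rec[OF assms(1), of x] by (simp add: theta_prod_def)
  finally show ?thesis .
qed

lemma theta_prod_reflect: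
  assumes "q \<noteq> 0"
  shows "theta_prod (q / x) q = theta_prod x q"
  using assms by (simp add: theta_prod_def mult.commute)

lemma norm_mult_power_le:
  fixes x q :: complex
  assumes "norm q < 1"
  shows "norm (x * q ^ k) \<le> norm x" "norm (q ^ k / x) \<le> 1 / norm x"
proof -
  have "norm q ^ k \<le> 1"
    using assms by (intro power_le_one) auto
  then show "norm (x * q ^ k) \<le> norm x" "norm (q ^ k / x) \<le> 1 / norm x"
    by (auto simp: norm_mult norm_power norm_divide mult_left_le intro: divide_right_mono)
qed

lemma norm_theta_tail_le:
  assumes q: "norm q < 1"
  shows "norm (qpoch_inf (x * q ^ j) q * qpoch_inf (q ^ k / x) q)
    \<le> exp ((norm x + 1 / norm x) / (1 - norm q))"
proof -
  have "norm (qpoch_inf (x * q ^ j) q) \<le> exp (norm x / (1 - norm q))"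
    using q norm_mult_power_le(1)[OF q, of x j]
    by (intro order_trans[OF norm_qpoch_inf_le[OF q]]) (simp add: divide_right_mono)
  moreover have "norm (qpoch_inf (q ^ k / x) q) \<le> exp ((1 / norm x) / (1 - norm q))"
    using q norm_mult_power_le(2)[OF q, of k x]
    by (intro order_trans[OF norm_qpoch_inf_le[OF q]]) (simp only: exp_le_cancel_iff, intro divide_right_mono, auto)
  ultimately have "norm (qpoch_inf (x * q ^ j) q) * norm (qpoch_inf (q ^ k / x) q)
      \<le> exp (norm x / (1 - norm q)) * exp ((1 / norm x) / (1 - norm q))"
    by (intro mult_mono) auto
  then show ?thesis
    by (simp add: norm_mult add_divide_distrib flip: exp_add)
qed

lemma norm_theta_term_le:
  assumes "norm q < 1" "n \<le> e"
  shows "norm (q ^ e * qpoch_inf (x * q ^ j) q * qpoch_inf (q ^ k / x) q)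
    \<le> exp ((norm x + 1 / norm x) / (1 - norm q)) * norm q ^ n"
proof -
  have "norm q ^ e \<le> norm q ^ n"
    using assms by (intro power_decreasing) auto
  from mult_mono[OF this norm_theta_tail_le[OF assms(1)], of x j k] show ?thesis
    by (simp add: norm_mult norm_power mult_ac)
qed

lemma summable_theta_term:
  assumes "norm q < 1" "\<And>n. n \<le> e n"
  shows "summable (\<lambda>n. q ^ e n * qpoch_inf (x * q ^ j n) q * qpoch_inf (q ^ k n / x) q)"
  by (rule summable_comparison_test'[where g = "\<lambda>n. exp ((norm x + 1 / norm x) / (1 - norm q)) * norm q ^ n"])
     (use assms in \<open>auto intro!: summable_mult summable_geometric norm_theta_term_le\<close>)

lemma le_square_nat: "n \<le> (n::nat)\<^sup>2"
  by (cases n) (auto simp: power2_eq_square)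

text \<open>Writing \<open>t n = q ^ n\<^sup>2 (x q\<^sup>n; q) (q\<^sup>n\<^sup>+\<^sup>1 / x; q)\<close>, the difference of the two summands
  is \<open>t (n + 1) - t n\<close>.\<close>

lemma g_num_alt:
  assumes q: "norm q < 1" and x: "x \<noteq> 0"
  shows "x * g_num x q =
    (\<Sum>n. q ^ n\<^sup>2 * qpoch_inf (x * q ^ (n + 1)) q * qpoch_inf (q ^ (n + 1) / x) q) - theta_prod x q"
proof -
  define t where "t = (\<lambda>n. q ^ n\<^sup>2 * qpoch_inf (x * q ^ n) q * qpoch_inf (q ^ (n + 1) / x) q)"
  define a where "a = (\<lambda>n. q ^ (n * (n + 1)) * qpoch_inf (x * q ^ (n + 1)) q * qpoch_inf (q ^ (n + 2) / x) q)"
  define m where "m = (\<lambda>n. q ^ n\<^sup>2 * qpoch_inf (x * q ^ (n + 1)) q * qpoch_inf (q ^ (n + 1) / x) q)"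
  have a: "summable a"
    unfolding a_def by (rule summable_theta_term[OF q]) auto
  have m: "summable m"
    unfolding m_def by (rule summable_theta_term[OF q]) (rule le_square_nat)
  have t: "summable t"
    unfolding t_def by (rule summable_theta_term[OF q]) (rule le_square_nat)
  have "x * a n - m n = t (Suc n) - t n" for n
  proof -
    define A where "A = qpoch_inf (x * q ^ (n + 1)) q"
    define B where "B = qpoch_inf (q ^ (n + 2) / x) q"
    have A: "qpoch_inf (x * q ^ n) q = (1 - x * q ^ n) * A"
      using qpoch_inf_rec[OF q, of "x * q ^ n"] by (simp add: A_def mult_ac)
    have B: "qpoch_inf (q ^ (n + 1) / x) q = (1 - q ^ (n + 1) / x) * B"
      using qpoch_inf_rec[OF q, of "q ^ (n + 1) / x"] by (simp add: B_def mult_ac)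
    have e: "n * (n + 1) = n\<^sup>2 + n" "(Suc n)\<^sup>2 = n\<^sup>2 + n + (n + 1)"
      by (auto simp: power2_eq_square)
    have eqs: "t n = q ^ n\<^sup>2 * ((1 - x * q ^ n) * A) * ((1 - q ^ (n + 1) / x) * B)"
      "t (Suc n) = q ^ (n\<^sup>2 + n + (n + 1)) * A * B"
      "a n = q ^ (n\<^sup>2 + n) * A * B"
      "m n = q ^ n\<^sup>2 * A * ((1 - q ^ (n + 1) / x) * B)"
      unfolding t_def a_def m_def A B e by (simp_all add: A_def B_def)
    show ?thesis
      unfolding eqs using x by (simp add: field_simps power_add)
  qed
  moreover have "(\<lambda>n. t (Suc n) - t n) sums (0 - t 0)"
    by (rule telescope_sums) (rule summable_LIMSEQ_zero[OF t])
  moreover have "(\<lambda>n. x * a n - m n) sums (x * suminf a - suminf m)"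
    by (intro sums_diff sums_mult summable_sums a m)
  ultimately have "x * suminf a - suminf m = - t 0"
    using sums_unique2 by fastforce
  then show ?thesis
    by (simp add: g_num_def a_def m_def t_def theta_prod_def algebra_simps)
qed

lemma g_num_reflect:
  assumes "x \<noteq> 0" "q \<noteq> 0"
  shows "g_num (q / x) q = g_num x q"
  using assms by (simp add: g_num_def mult_ac)

text \<open>The series with exponents \<open>n^2\<close> in \<open>g_num_alt\<close> is unchanged
  when \<open>x\<close> is inverted, so comparing that identity at \<open>x\<close> and at
  \<open>inverse x\<close> relates the two values of \<open>g_num\<close>. The reflection then turns
  \<open>inverse x\<close> into \<open>x * q\<close>.\<close>

lemma g_num_shift:
  assumes q: "norm q < 1" "q \<noteq> 0" and x: "x \<noteq> 0"
  shows "g_num (x * q) q = (1 + x) * theta_prod x q + x\<^sup>2 * g_num x q"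
proof -
  have "inverse x * g_num (inverse x) q + theta_prod (inverse x) q = x * g_num x q + theta_prod x q"
    using g_num_alt[OF q(1) x] g_num_alt[OF q(1), of "inverse x"] x
    by (simp add: field_simps)
  moreover have "g_num (inverse x) q = g_num (x * q) q"
    using g_num_reflect[of "x * q" q] x q by (simp add: field_simps)
  moreover have "theta_prod (inverse x) q = - theta_prod x q / x"
    using theta_prod_reflect[of q "x * q"] theta_prod_shift[OF q x] x q by (simp add: field_simps)
  ultimately show ?thesis
    using x by (simp add: field_simps power2_eq_square)
qed

text \<open>At \<open>x = 1\<close> the tails of the products turn the series into a Durfee
  rectangle sum with excess 1.\<close>

lemma g_num_one:
  assumes q: "norm q < 1"
  shows "g_num 1 q = qpoch_inf q q"
proof -
  let ?P = "qpoch_inf q q"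
  have "q ^ (n * (n + 1)) * qpoch_inf (q ^ (n + 1)) q * qpoch_inf (q ^ (n + 2)) q
      = ?P\<^sup>2 * durfee_term q 1 n" for n
    using qpoch_inf_split[OF q, of q n] qpoch_inf_split[OF q, of q "n + 1"] qpoch_nonzero[OF q q]
    by (simp add: durfee_term_def field_simps power2_eq_square)
  moreover have "(\<lambda>n. ?P\<^sup>2 * durfee_term q 1 n) sums (?P\<^sup>2 * (1 / ?P))"
    by (intro sums_mult durfee_sums q)
  ultimately show ?thesis
    using qpoch_inf_nonzero[OF q q] by (simp add: g_num_def sums_iff power2_eq_square)
qed

lemma theta_prod_eq_qpoch:
  assumes q: "norm q < 1"
  shows "theta_prod x q = qpoch x q i * qpoch (q / x) q j *
    (qpoch_inf (x * q ^ i) q * qpoch_inf (q ^ (j + 1) / x) q)"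
  using qpoch_inf_split[OF q, of x i] qpoch_inf_split[OF q, of "q / x" j]
  by (simp add: theta_prod_def mult_ac)

lemma g_conv_g_num:
  assumes q: "norm q < 1" and x: "x \<noteq> 0" and nz: "theta_prod x q \<noteq> 0"
  shows "g x q = g_num x q / theta_prod x q"
proof -
  define S where "S = (\<lambda>n. q ^ n\<^sup>2 / (qpoch x q (n + 1) * qpoch (q / x) q n))"
  have "q ^ n\<^sup>2 * qpoch_inf (x * q ^ (n + 1)) q * qpoch_inf (q ^ (n + 1) / x) q
      = theta_prod x q * S n" for n
    unfolding S_def using theta_prod_eq_qpoch[OF q, of x "n + 1" n] nz by (auto simp: field_simps)
  moreover have "summable (\<lambda>n. q ^ n\<^sup>2 * qpoch_inf (x * q ^ (n + 1)) q * qpoch_inf (q ^ (n + 1) / x) q)"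
    by (rule summable_theta_term[OF q]) (rule le_square_nat)
  ultimately have "x * g_num x q = theta_prod x q * suminf S - theta_prod x q"
    using g_num_alt[OF q x] nz suminf_mult[of S "theta_prod x q"] by (simp only: summable_cmult_iff) simp
  moreover have "g x q = inverse x * (- 1 + suminf S)"
    by (simp add: g_def S_def)
  moreover have "inverse x * (- 1 + suminf S) = (theta_prod x q * suminf S - theta_prod x q) / x / theta_prod x q"
    using x nz by (simp add: field_simps)
  ultimately show ?thesis
    using x by (metis nonzero_mult_div_cancel_left)
qed

text \<open>The form in which the generating function of odd Durfee symbols arises: one denominator
  with \<open>n + 1\<close> factors for each row.\<close>

lemma g_num_sums:
  assumes q: "norm q < 1" and nz: "theta_prod x q \<noteq> 0"
  shows "(\<lambda>n. q ^ (n * (n + 1)) / (qpoch x q (n + 1) * qpoch (q / x) q (n + 1))) sums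
    (g_num x q / theta_prod x q)"
proof -
  have "q ^ (n * (n + 1)) / (qpoch x q (n + 1) * qpoch (q / x) q (n + 1)) =
    q ^ (n * (n + 1)) * qpoch_inf (x * q ^ (n + 1)) q * qpoch_inf (q ^ (n + 2) / x) q / theta_prod x q" for n
    using theta_prod_eq_qpoch[OF q, of x "n + 1" "n + 1"] nz by (auto simp: field_simps)
  moreover have "summable (\<lambda>n. q ^ (n * (n + 1)) * qpoch_inf (x * q ^ (n + 1)) q * qpoch_inf (q ^ (n + 2) / x) q)"
    by (rule summable_theta_term[OF q]) auto
  ultimately show ?thesis
    by (simp add: g_num_def sums_divide summable_sums)
qed

lemma g_reflect:
  assumes q: "norm q < 1" "q \<noteq> 0" and x: "x \<noteq> 0" and nz: "theta_prod x q \<noteq> 0"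
  shows "g (q / x) q = g x q"
  using assms by (simp add: g_conv_g_num theta_prod_reflect g_num_reflect)

lemma g_shift:
  assumes q: "norm q < 1" "q \<noteq> 0" and x: "x \<noteq> 0" and nz: "theta_prod x q \<noteq> 0"
  shows "g (x * q) q = - (x ^ 3 * g x q) - x - x\<^sup>2"
proof -
  have "theta_prod (x * q) q \<noteq> 0"
    using assms by (simp add: theta_prod_shift)
  then have "g (x * q) q = g_num (x * q) q / theta_prod (x * q) q"
    using assms by (intro g_conv_g_num) auto
  also have "\<dots> = ((1 + x) * theta_prod x q + x\<^sup>2 * g_num x q) / (- theta_prod x q / x)"
    using assms by (simp only: theta_prod_shift g_num_shift not_False_eq_True)
  also have "\<dots> = - (x ^ 3 * (g_num x q / theta_prod x q)) - x - x\<^sup>2"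
    using assms by (simp add: field_simps eval_nat_numeral)
  finally show ?thesis
    using assms by (simp add: g_conv_g_num)
qed

lemma holomorphic_g_num:
  assumes q: "norm q < 1"
  shows "(\<lambda>x. g_num x q) holomorphic_on - {0}"
proof (rule holomorphic_uniform_sequence)
  let ?f = "\<lambda>n x. q ^ (n * (n + 1)) * qpoch_inf (x * q ^ (n + 1)) q * qpoch_inf (q ^ (n + 2) / x) q"
  show "open (- {0::complex})" by auto
  show "(\<lambda>x. \<Sum>k<n. ?f k x) holomorphic_on - {0}" for n
    using q by (intro holomorphic_intros) auto
  fix z :: complex
  assume "z \<in> - {0}"
  then have z: "z \<noteq> 0" by auto
  \<comment> \<open>This radius keeps \<open>norm x\<close> between \<open>d\<close> and
    \<open>norm z + d\<close>, so the exponential bound, which involves both \<open>norm x\<close>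
    and its inverse, becomes uniform on the ball.\<close>
  define d where "d = norm z / 2"
  have d: "d > 0" using z by (simp add: d_def)
  have bounds: "d \<le> norm x" "norm x \<le> norm z + d" if "x \<in> cball z d" for x
    using that norm_triangle_ineq2[of z x] norm_triangle_ineq2[of x z]
    by (auto simp: dist_norm d_def norm_minus_commute)
  have "uniform_limit (cball z d) (\<lambda>n x. \<Sum>k<n. ?f k x) (\<lambda>x. \<Sum>k. ?f k x) sequentially"
  proof (rule Weierstrass_m_test)
    fix n x assume x: "x \<in> cball z d"
    have "norm x + 1 / norm x \<le> norm z + d + 1 / d"
      using bounds[OF x] d by (intro add_mono frac_le) auto
    then have "exp ((norm x + 1 / norm x) / (1 - norm q)) \<le> exp ((norm z + d + 1 / d) / (1 - norm q))"
      using q by (simp add: divide_right_mono)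
    then have "exp ((norm x + 1 / norm x) / (1 - norm q)) * norm q ^ n
        \<le> exp ((norm z + d + 1 / d) / (1 - norm q)) * norm q ^ n"
      by (intro mult_right_mono) auto
    moreover have "norm (?f n x) \<le> exp ((norm x + 1 / norm x) / (1 - norm q)) * norm q ^ n"
      by (rule norm_theta_term_le[OF q]) auto
    ultimately show "norm (?f n x) \<le> exp ((norm z + d + 1 / d) / (1 - norm q)) * norm q ^ n"
      by linarith
  next
    show "summable (\<lambda>n. exp ((norm z + d + 1 / d) / (1 - norm q)) * norm q ^ n)"
      using q by (intro summable_mult summable_geometric) auto
  qed
  moreover have "cball z d \<subseteq> - {0}"
    using bounds(1)[of 0] d by auto
  ultimately show "\<exists>d>0. cball z d \<subseteq> - {0} \<and>
      uniform_limit (cball z d) (\<lambda>n x. \<Sum>k<n. ?f k x) (\<lambda>x. g_num x q) sequentially"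
    using d by (auto simp: g_num_def)
qed

lemma holomorphic_on_g_num_compose [holomorphic_intros]:
  assumes "norm q < 1" "f holomorphic_on A" "\<And>x. x \<in> A \<Longrightarrow> f x \<noteq> 0"
  shows "(\<lambda>x. g_num (f x) q) holomorphic_on A"
proof -
  have "f ` A \<subseteq> - {0}"
    using assms(3) by auto
  with holomorphic_on_compose_gen[OF assms(2) holomorphic_g_num[OF assms(1)]] show ?thesis
    by (simp add: o_def)
qed

lemma holomorphic_on_theta_prod_compose [holomorphic_intros]:
  assumes "norm q < 1" "f holomorphic_on A" "\<And>x. x \<in> A \<Longrightarrow> f x \<noteq> 0"
  shows "(\<lambda>x. theta_prod (f x) q) holomorphic_on A"
  unfolding theta_prod_def using assms by (intro holomorphic_intros) auto

text \<open>Such a function descends to a holomorphic function on a torus.\<close>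

lemma multiplicatively_periodic_constant:
  fixes f :: "complex \<Rightarrow> complex"
  assumes hol: "f holomorphic_on - {0}"
    and r: "norm r < 1" "r \<noteq> 0"
    and per: "\<And>x. x \<noteq> 0 \<Longrightarrow> f (x * r) = f x"
    and xy: "x \<noteq> 0" "y \<noteq> 0"
  shows "f x = f y"
proof -
  define A where "A = {z::complex. norm r \<le> norm z \<and> norm z \<le> 1}"
  have per_n: "f (x * r ^ n) = f x" if "x \<noteq> 0" for x n
  proof (induction n)
    case (Suc n)
    then show ?case using per[of "x * r ^ n"] that r by (simp add: mult_ac)
  qed simp
  have "A = cball 0 1 - ball 0 (norm r)"
    by (auto simp: A_def)
  then have "compact A"
    by (simp add: compact_diff)
  moreover have "continuous_on A f"
    by (rule continuous_on_subset[OF holomorphic_on_imp_continuous_on[OF hol]])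
       (use r in \<open>auto simp: A_def\<close>)
  ultimately have bA: "bounded (f ` A)"
    by (intro compact_imp_bounded compact_continuous_image)
  have into: "f x \<in> f ` A" if "x \<noteq> 0" for x
  proof -
    have small: "\<exists>n. norm (x * r ^ n) \<le> 1" for x
    proof -
      have "(\<lambda>n. norm (x * r ^ n)) \<longlonglongrightarrow> 0"
        using r by (intro tendsto_norm_zero tendsto_mult_right_zero LIMSEQ_power_zero)
      then have "\<forall>\<^sub>F n in sequentially. norm (x * r ^ n) < 1"
        by (rule order_tendstoD) simp
      then obtain n where "norm (x * r ^ n) < 1"
        by (auto simp: eventually_sequentially)
      then show ?thesis by (intro exI[of _ n]) simp
    qed
    have down: "f x \<in> f ` A" if "x \<noteq> 0" "norm x > norm r" for x
    proof -
      \<comment> \<open>The first multiple that enters the unit disc cannot jump over the annulus: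
        its predecessor has norm above 1, or there is no predecessor and
        \<open>norm r < norm x\<close> holds already.\<close>
      define n where "n = (LEAST n. norm (x * r ^ n) \<le> 1)"
      have n: "norm (x * r ^ n) \<le> 1"
        unfolding n_def by (rule LeastI_ex[OF small])
      have "norm r \<le> norm (x * r ^ n)"
      proof (cases n)
        case 0
        then show ?thesis using that by simp
      next
        case (Suc k)
        then have "norm (x * r ^ k) > 1"
          using not_less_Least[of k "\<lambda>n. norm (x * r ^ n) \<le> 1"] by (auto simp: n_def)
        then have "norm r * 1 \<le> norm r * norm (x * r ^ k)"
          by (intro mult_left_mono) auto
        then show ?thesis by (simp add: Suc norm_mult mult_ac)
      qed
      with n have "x * r ^ n \<in> A" by (simp add: A_def)
      then show ?thesis using per_n[OF that(1), of n] by (metis image_eqI)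
    qed
    \<comment> \<open>A point too close to 0 is first moved outwards:
      \<open>norm r ^ n \<le> norm x\<close>, so dividing by \<open>r ^ Suc n\<close> gives a norm
      above \<open>norm r\<close>, and the inward argument applies.\<close>
    obtain n where n: "norm (inverse x * r ^ n) \<le> 1" using small by blast
    define y where "y = x / r ^ Suc n"
    have "y \<noteq> 0" using that r by (simp add: y_def)
    moreover have "norm r < norm y"
    proof -
      have "norm r ^ n \<le> norm x"
        using n that by (simp add: norm_mult norm_inverse norm_power norm_divide inverse_eq_divide pos_divide_le_eq)
      moreover have "norm r ^ (n + 2) < norm r ^ n"
        using r by (intro power_strict_decreasing) auto
      ultimately have "norm r * norm r ^ Suc n < norm x"
        by simp
      then show ?thesis
        using r by (simp add: y_def norm_divide norm_power pos_less_divide_eq del: power_Suc)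
    qed
    ultimately have "f y \<in> f ` A" by (rule down)
    moreover have "f y = f x"
      using per_n[OF \<open>y \<noteq> 0\<close>, of "Suc n"] r by (simp add: y_def)
    ultimately show ?thesis by simp
  qed
  \<comment> \<open>Liouville's theorem needs an entire function; composing with \<open>exp\<close>
    unrolls the punctured plane.\<close>
  have "bounded (range (\<lambda>w. f (exp w)))"
    by (rule bounded_subset[OF bA]) (auto intro: into)
  moreover have "(\<lambda>w. f (exp w)) holomorphic_on UNIV"
  proof -
    have "range (exp :: complex \<Rightarrow> complex) \<subseteq> - {0}"
      by auto
    with holomorphic_on_compose_gen[OF holomorphic_on_exp[of UNIV] hol] show ?thesis
      by (simp add: o_def)
  qed
  ultimately have "(\<lambda>w. f (exp w)) constant_on UNIV"
    by (intro Liouville_theorem)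
  then obtain c where "\<And>w. f (exp w) = c"
    by (auto simp: constant_on_def)
  then show ?thesis
    using xy by (metis exp_Ln)
qed

section \<open>The bisection identity\<close>

text \<open>The even part of \<open>g\<close> plus \<open>q * g (- q * x^2) (q ^ 4)\<close>,
  multiplied by all three theta products involved so that no poles remain.\<close>

definition bisection_num :: "complex \<Rightarrow> complex \<Rightarrow> complex" where
  "bisection_num q x =
    (g_num x q * theta_prod (- x) q + g_num (- x) q * theta_prod x q) / 2 *
      theta_prod (- q * x\<^sup>2) (q ^ 4) +
    q * g_num (- q * x\<^sup>2) (q ^ 4) * theta_prod x q * theta_prod (- x) q"

text \<open>Each theta product acquires the factor \<open>1 / (q * x^2)\<close> and each
  \<open>g_num\<close> the factor \<open>q^2 * x ^ 4\<close> plus a multiple of its theta product,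
  so the homogeneous parts are invariant. Relative to the three theta products divided by
  \<open>q^2 * x ^ 4\<close>, the inhomogeneous parts of the first summand average to
  \<open>- q + q^2 * x^2\<close>, the odd powers of \<open>x\<close> cancelling, while the last
  summand gives \<open>q * (1 - q * x^2)\<close>. This cancellation explains the choice of the
  argument \<open>- q * x^2\<close>, the base \<open>q ^ 4\<close> and the prefactor
  \<open>q\<close>.\<close>

lemma bisection_num_periodic:
  assumes q: "norm q < 1" "q \<noteq> 0" and x: "x \<noteq> 0"
  shows "bisection_num q (x * q\<^sup>2) = bisection_num q x"
proof -
  have q4: "norm (q ^ 4) < 1" "q ^ 4 \<noteq> 0"
    using q by (auto intro: norm_power_less_one)
  have T: "theta_prod (y * q\<^sup>2) q = theta_prod y q / (q * y\<^sup>2)" if "y \<noteq> 0" for y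
  proof -
    have "theta_prod (y * q\<^sup>2) q = - (- theta_prod y q / y) / (y * q)"
      using theta_prod_shift[OF q that] theta_prod_shift[OF q, of "y * q"] that q
      by (simp add: power2_eq_square mult.assoc)
    then show ?thesis using that q by (simp add: field_simps power2_eq_square)
  qed
  have G: "g_num (y * q\<^sup>2) q = - ((1 + y * q) * theta_prod y q / y) +
      (y * q)\<^sup>2 * ((1 + y) * theta_prod y q + y\<^sup>2 * g_num y q)" if "y \<noteq> 0" for y
    using g_num_shift[OF q that] theta_prod_shift[OF q that] g_num_shift[OF q, of "y * q"] that q
    by (simp add: power2_eq_square mult.assoc)
  let ?Y = "- q * x\<^sup>2"
  have Y: "- q * (x * q\<^sup>2)\<^sup>2 = ?Y * q ^ 4" "?Y \<noteq> 0"
    using q x by (auto simp: power_mult_distrib eval_nat_numeral)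
  have mx: "- (x * q\<^sup>2) = (- x) * q\<^sup>2" by simp
  show ?thesis
    unfolding bisection_num_def Y(1) mx
    unfolding T[OF x] T[of "- x", unfolded neg_equal_0_iff_equal, OF x]
      G[OF x] G[of "- x", unfolded neg_equal_0_iff_equal, OF x]
      theta_prod_shift[OF q4 Y(2)] g_num_shift[OF q4 Y(2)]
    using q x by (simp add: divide_simps) (simp add: algebra_simps eval_nat_numeral)
qed

text \<open>The constant is read off at \<open>x = 1\<close>, a zero of
  \<open>theta_prod x q\<close>: two of the three terms vanish there, and the remaining one contains
  the known value \<open>g_num 1 q\<close>.\<close>

lemma bisection_num_const:
  assumes q: "norm q < 1" "q \<noteq> 0" and x: "x \<noteq> 0"
  shows "bisection_num q x = J 2 q ^ 4 / (J 1 q ^ 2 * J 4 q)"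
proof -
  have q2: "norm (q\<^sup>2) < 1" "norm (q ^ 4) < 1"
    using q by (auto intro: norm_power_less_one)
  have "bisection_num q x = bisection_num q 1"
  proof (rule multiplicatively_periodic_constant[where f = "bisection_num q" and r = "q\<^sup>2"])
    show "bisection_num q holomorphic_on - {0}"
      unfolding bisection_num_def using q q2 by (intro holomorphic_intros) auto
  qed (use q q2 x bisection_num_periodic[OF q] in auto)
  also have "theta_prod 1 q = 0"
    using q by (simp add: theta_prod_def)
  then have "bisection_num q 1 = qpoch_inf q q * theta_prod (- 1) q / 2 * theta_prod (- q) (q ^ 4)"
    using q by (simp add: bisection_num_def g_num_one)
  also have "theta_prod (- 1) q = 2 * (J 2 q / J 1 q) ^ 2"
    using qpoch_inf_rec[OF q(1), of "- 1"] qpoch_inf_minus_J[OF q(1), of 1]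
    by (simp add: theta_prod_def power2_eq_square)
  also have "theta_prod (- q) (q ^ 4) = J 2 q ^ 2 / (J 1 q * J 4 q)"
  proof -
    have "q ^ 4 / (- q) = - q * q\<^sup>2"
      using q by (simp add: eval_nat_numeral)
    then have "theta_prod (- q) (q ^ 4) = qpoch_inf (- q) ((q\<^sup>2)\<^sup>2) * qpoch_inf (- q * q\<^sup>2) ((q\<^sup>2)\<^sup>2)"
      by (simp only: theta_prod_def) simp
    then show ?thesis
      using qpoch_inf_bisect[OF q2(1), of "- q"] qpoch_inf_minus_odd_J[OF q(1), of 1] by simp
  qed
  also have "qpoch_inf q q = J 1 q" by (simp add: J_def)
  finally show ?thesis
    using J_nonzero[OF q(1), of 1] J_nonzero[OF q(1), of 4] by (simp add: field_simps eval_nat_numeral)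
qed

theorem g_bisection:
  assumes q: "norm q < 1" "q \<noteq> 0" and x: "x \<noteq> 0"
    and nz: "theta_prod x q \<noteq> 0" "theta_prod (- x) q \<noteq> 0" "theta_prod (- q * x\<^sup>2) (q ^ 4) \<noteq> 0"
  shows "(g x q + g (- x) q) / 2 = - q * g (- q * x\<^sup>2) (q ^ 4) +
    J 2 q ^ 4 / (J 1 q ^ 2 * J 4 q) /
      (theta_prod x q * theta_prod (- x) q * theta_prod (- q * x\<^sup>2) (q ^ 4))"
proof -
  have q4: "norm (q ^ 4) < 1"
    using q by (auto intro: norm_power_less_one)
  have gs: "g x q = g_num x q / theta_prod x q" "g (- x) q = g_num (- x) q / theta_prod (- x) q"
    "g (- q * x\<^sup>2) (q ^ 4) = g_num (- q * x\<^sup>2) (q ^ 4) / theta_prod (- q * x\<^sup>2) (q ^ 4)"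
    using q x q4 nz by (auto intro!: g_conv_g_num)
  show ?thesis
    unfolding bisection_num_const[OF q x, symmetric] bisection_num_def gs
    using nz by (simp add: divide_simps)
qed

subsection \<open>Averages over eighth roots of unity\<close>

lemma theta_prod_nonzero:
  assumes "norm q < 1" "norm x < 1" "norm (q / x) < 1"
  shows "theta_prod x q \<noteq> 0"
  using qpoch_inf_nonzero[OF assms(1)] assms by (auto simp: theta_prod_def)

lemma theta_prod_mult_minus:
  assumes "norm q < 1"
  shows "theta_prod x q * theta_prod (- x) q = theta_prod (x\<^sup>2) (q\<^sup>2)"
  using qpoch_inf_mult_minus[OF assms, of x] qpoch_inf_mult_minus[OF assms, of "q / x"]
  by (simp add: theta_prod_def power_divide mult_ac)

lemma square_minus_one:
  fixes s :: complex
  assumes "s\<^sup>2 = - 1"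
  shows "s \<noteq> 0" "1 / s = - s" "1 + s \<noteq> 0"
proof -
  show s: "s \<noteq> 0" using assms by auto
  show "1 / s = - s" using assms s by (simp add: field_simps power2_eq_square)
  show "1 + s \<noteq> 0"
  proof
    assume "1 + s = 0"
    then have "s = - 1" by (simp add: eq_neg_iff_add_eq_0 add.commute)
    with assms show False by simp
  qed
qed

text \<open>Because \<open>1 / s = - s\<close>, the arguments of the two products are opposite, and
  the pair collapses to a single product with squared base.\<close>

lemma theta_prod_imag:
  assumes q: "norm q < 1" "q \<noteq> 0" and s: "s\<^sup>2 = - 1" and k: "0 < k"
  shows "theta_prod (s * q ^ k) (q ^ (2 * k)) = J (4 * k) q ^ 2 / (J (2 * k) q * J (8 * k) q)"
proof -
  have "q ^ (2 * k) / (s * q ^ k) = - (s * q ^ k)"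
  proof -
    have "q ^ (2 * k) / (s * q ^ k) = 1 / s * q ^ k"
      using q by (simp add: mult_2 power_add)
    then show ?thesis
      unfolding square_minus_one(2)[OF s] by simp
  qed
  then have "theta_prod (s * q ^ k) (q ^ (2 * k)) = qpoch_inf ((s * q ^ k)\<^sup>2) ((q ^ (2 * k))\<^sup>2)"
    using qpoch_inf_mult_minus[of "q ^ (2 * k)" "s * q ^ k"] norm_power_less_one[OF q(1), of "2 * k"] k
    by (simp add: theta_prod_def)
  also have "\<dots> = qpoch_inf (- (q ^ (2 * k))) (q ^ (2 * (2 * k)))"
    using s by (simp add: power_mult_distrib power_mult[symmetric] mult.commute)
  finally show ?thesis
    using qpoch_inf_minus_odd_J[OF q(1), of "2 * k"] k by simp
qed

text \<open>Only the product over \<open>x\<close> and \<open>- x\<close> is evaluated, since it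
  depends on \<open>x^2\<close> alone; it is nonzero, hence so is each factor.\<close>

lemma theta_prod_sqrt_imag:
  assumes q: "norm q < 1" "q \<noteq> 0" and s: "s\<^sup>2 = - 1" and x: "x\<^sup>2 = s * q"
  shows "theta_prod x q * theta_prod (- x) q = J 4 q ^ 2 / (J 2 q * J 8 q)"
    "x \<noteq> 0" "theta_prod x q \<noteq> 0" "theta_prod (- x) q \<noteq> 0"
proof -
  show *: "theta_prod x q * theta_prod (- x) q = J 4 q ^ 2 / (J 2 q * J 8 q)"
    using theta_prod_imag[OF q s, of 1] theta_prod_mult_minus[OF q(1), of x] x by simp
  show "x \<noteq> 0" using x q square_minus_one[OF s] by auto
  have "J 4 q ^ 2 / (J 2 q * J 8 q) \<noteq> 0"
    using J_nonzero[OF q(1)] by simp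
  with * show "theta_prod x q \<noteq> 0" "theta_prod (- x) q \<noteq> 0"
    by auto
qed

lemma g_bisection_sqrt_imag:
  assumes q: "norm q < 1" "q \<noteq> 0" and s: "s\<^sup>2 = - 1" and x: "x\<^sup>2 = s * q"
  shows "(g x q + g (- x) q) / 2 =
    - q * g (- s * q\<^sup>2) (q ^ 4) + J 2 q ^ 5 * J 16 q / (J 1 q ^ 2 * J 4 q ^ 2 * J 8 q)"
proof -
  note nz = J_nonzero[OF q(1)]
  have s': "(- s)\<^sup>2 = - 1" using s by simp
  have Y: "- q * x\<^sup>2 = - s * q\<^sup>2"
    unfolding x by (simp add: power2_eq_square)
  have T: "theta_prod (- s * q\<^sup>2) (q ^ 4) = J 8 q ^ 2 / (J 4 q * J 16 q)"
    using theta_prod_imag[OF q s', of 2] by simp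
  have "(g x q + g (- x) q) / 2 = - q * g (- s * q\<^sup>2) (q ^ 4) +
      J 2 q ^ 4 / (J 1 q ^ 2 * J 4 q) / (J 4 q ^ 2 / (J 2 q * J 8 q) * (J 8 q ^ 2 / (J 4 q * J 16 q)))"
    using g_bisection[OF q theta_prod_sqrt_imag(2-4)[OF assms]] nz
    unfolding Y T theta_prod_sqrt_imag(1)[OF assms] by simp
  also have "J 2 q ^ 4 / (J 1 q ^ 2 * J 4 q) / (J 4 q ^ 2 / (J 2 q * J 8 q) * (J 8 q ^ 2 / (J 4 q * J 16 q)))
      = J 2 q ^ 5 * J 16 q / (J 1 q ^ 2 * J 4 q ^ 2 * J 8 q)"
    using nz[of 1] nz[of 2] nz[of 4] nz[of 8] nz[of 16]
    by (simp add: divide_simps) algebra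
  finally show ?thesis .
qed

lemma g_bisection_imag:
  assumes q: "norm q < 1" "q \<noteq> 0"
  shows "(g (\<i> * q\<^sup>2) (q ^ 4) + g (- \<i> * q\<^sup>2) (q ^ 4)) / 2 =
    - (q ^ 4) * g (q ^ 8) (q ^ 16) + J 16 q ^ 3 / J 8 q ^ 2"
proof -
  note nz = J_nonzero[OF q(1)]
  have q4: "norm (q ^ 4) < 1" "q ^ 4 \<noteq> 0"
    using q by (auto intro: norm_power_less_one)
  have t: "theta_prod (\<i> * q\<^sup>2) (q ^ 4) = J 8 q ^ 2 / (J 4 q * J 16 q)"
    "theta_prod (- (\<i> * q\<^sup>2)) (q ^ 4) = J 8 q ^ 2 / (J 4 q * J 16 q)"
    using theta_prod_imag[OF q, of \<i> 2] theta_prod_imag[OF q, of "- \<i>" 2] by simp_all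
  have Y: "- (q ^ 4) * (\<i> * q\<^sup>2)\<^sup>2 = q ^ 8"
    by (simp add: power_mult_distrib power_mult[symmetric] power_add[symmetric])
  have "q ^ 16 / q ^ 8 = q ^ 8"
    using q by (simp add: power_diff[symmetric])
  then have T: "theta_prod (q ^ 8) ((q ^ 4) ^ 4) = (J 8 q / J 16 q) ^ 2"
    using qpoch_inf_odd_J[OF q(1), of 8]
    by (simp add: theta_prod_def power2_eq_square power_mult[symmetric])
  have "(g (\<i> * q\<^sup>2) (q ^ 4) + g (- (\<i> * q\<^sup>2)) (q ^ 4)) / 2 = - (q ^ 4) * g (q ^ 8) ((q ^ 4) ^ 4) +
     J 8 q ^ 4 / (J 4 q ^ 2 * J 16 q) /
     (J 8 q ^ 2 / (J 4 q * J 16 q) * (J 8 q ^ 2 / (J 4 q * J 16 q)) * (J 8 q / J 16 q) ^ 2)"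
    using g_bisection[OF q4, of "\<i> * q\<^sup>2"] nz q unfolding Y T t by (simp add: J_power)
  also have "J 8 q ^ 4 / (J 4 q ^ 2 * J 16 q) /
     (J 8 q ^ 2 / (J 4 q * J 16 q) * (J 8 q ^ 2 / (J 4 q * J 16 q)) * (J 8 q / J 16 q) ^ 2)
     = J 16 q ^ 3 / J 8 q ^ 2"
    using nz[of 4] nz[of 8] nz[of 16]
    by (simp add: divide_simps) algebra
  finally show ?thesis
    by (simp add: power_mult[symmetric])
qed

text \<open>The bisections for \<open>s = \<i>\<close> and \<open>s = - \<i>\<close> leave
  \<open>g\<close> at an opposite pair of arguments with base \<open>q ^ 4\<close>, ready for the
  second bisection. The eta quotient \<open>C\<close> mixes exponents modulo 4;
  \<open>phi_bisection\<close> splits it into a function of \<open>q ^ 4\<close> and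
  \<open>2 * q\<close> times another, and the second bisection takes away one of these two
  copies.\<close>

lemma g_quadrisection:
  assumes q: "norm q < 1" "q \<noteq> 0" and x: "x\<^sup>2 = \<i> * q" and y: "y\<^sup>2 = - \<i> * q"
  shows "(g x q + g (- x) q + g y q + g (- y) q) / 4 =
    q ^ 5 * g (q ^ 8) (q ^ 16) + J 8 q ^ 4 / (J 4 q ^ 2 * J 16 q) + q * (J 16 q ^ 3 / J 8 q ^ 2)"
proof -
  note nz = J_nonzero[OF q(1)]
  define C where "C = J 2 q ^ 5 * J 16 q / (J 1 q ^ 2 * J 4 q ^ 2 * J 8 q)"
  have "C = J 2 q ^ 5 / (J 1 q ^ 2 * J 4 q ^ 2) * (J 16 q / J 8 q)"
    by (simp add: C_def)
  also have "\<dots> = J 8 q ^ 4 / (J 4 q ^ 2 * J 16 q) + 2 * q * (J 16 q ^ 3 / J 8 q ^ 2)"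
    unfolding phi_bisection[OF q] using nz[of 4] nz[of 8] nz[of 16]
    by (simp add: divide_simps) algebra
  finally have C: "C = J 8 q ^ 4 / (J 4 q ^ 2 * J 16 q) + 2 * q * (J 16 q ^ 3 / J 8 q ^ 2)" .
  have 1: "(g x q + g (- x) q) / 2 = - q * g (- \<i> * q\<^sup>2) (q ^ 4) + C"
    unfolding C_def by (rule g_bisection_sqrt_imag[OF q _ x]) simp
  have 2: "(g y q + g (- y) q) / 2 = - q * g (\<i> * q\<^sup>2) (q ^ 4) + C"
    using g_bisection_sqrt_imag[OF q _ y] by (simp add: C_def)
  have "(g x q + g (- x) q + g y q + g (- y) q) / 4 =
      ((g x q + g (- x) q) / 2 + (g y q + g (- y) q) / 2) / 2"
    by (simp add: add_divide_distrib)
  also have "\<dots> = - q * ((g (\<i> * q\<^sup>2) (q ^ 4) + g (- \<i> * q\<^sup>2) (q ^ 4)) / 2) + C"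
    unfolding 1 2 by (simp add: field_simps)
  also have "\<dots> = - q * (- (q ^ 4) * g (q ^ 8) (q ^ 16) + J 16 q ^ 3 / J 8 q ^ 2) + C"
    unfolding g_bisection_imag[OF q] ..
  also have "\<dots> = q ^ 5 * g (q ^ 8) (q ^ 16) + J 8 q ^ 4 / (J 4 q ^ 2 * J 16 q) + q * (J 16 q ^ 3 / J 8 q ^ 2)"
    unfolding C by (simp add: algebra_simps eval_nat_numeral)
  finally show ?thesis .
qed

section \<open>Averages weighted by the cube of the root\<close>

text \<open>Undoing one shift by the base leads to \<open>theta_prod s\<close>. Its initial factor
  \<open>1 - s\<close> is split off, and the remaining two products have opposite arguments because
  \<open>1 / s = - s\<close>.\<close>

lemma theta_prod_imag_shift:
  assumes q: "norm q < 1" "q \<noteq> 0" and s: "s\<^sup>2 = - 1" and k: "0 < k"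
  shows "theta_prod (s * q ^ k) (q ^ k) = s * (1 - s) * (J (4 * k) q / J (2 * k) q)"
proof -
  have qk: "norm (q ^ k) < 1" "q ^ k \<noteq> 0"
    using q k by (auto intro: norm_power_less_one)
  note s' = square_minus_one[OF s]
  have "theta_prod (s * q ^ k) (q ^ k) = - theta_prod s (q ^ k) / s"
    using theta_prod_shift[OF qk s'(1)] .
  also have "\<dots> = - (1 / s) * theta_prod s (q ^ k)"
    by simp
  also have "\<dots> = s * theta_prod s (q ^ k)"
    unfolding s'(2) by simp
  also have "q ^ k / s = - (s * q ^ k)"
    using s'(2) by (metis divide_inverse inverse_eq_divide mult.commute mult_minus_left)
  then have "theta_prod s (q ^ k) = (1 - s) * (qpoch_inf (s * q ^ k) (q ^ k) * qpoch_inf (- (s * q ^ k)) (q ^ k))"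
    using qpoch_inf_rec[OF qk(1), of s] by (simp add: theta_prod_def)
  also have "qpoch_inf (s * q ^ k) (q ^ k) * qpoch_inf (- (s * q ^ k)) (q ^ k)
      = qpoch_inf (- (q ^ (2 * k))) (q ^ (2 * k))"
    unfolding qpoch_inf_mult_minus[OF qk(1)] power_mult_distrib s
    by (simp add: power_mult[symmetric] mult.commute)
  finally show ?thesis
    using qpoch_inf_minus_J[OF q(1), of "2 * k"] k by simp
qed

text \<open>In contrast to the unshifted case the constant depends on \<open>s\<close>: the theta
  product at \<open>- s * q ^ 4\<close> contributes the factor \<open>1 + s\<close>. The values of
  \<open>1 / (1 + s)\<close> at \<open>\<i>\<close> and \<open>- \<i>\<close> will add up to
  1.\<close>

lemma g_bisection_sqrt_imag_shift:
  assumes q: "norm q < 1" "q \<noteq> 0" and s: "s\<^sup>2 = - 1" and x: "x\<^sup>2 = s * q"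
  shows "(g (x * q) q + g (- x * q) q) / 2 =
    - q * g (- s * q ^ 4) (q ^ 4) +
    1 / (1 + s) * (q * J 2 q ^ 5 * J 8 q ^ 2 / (J 1 q ^ 2 * J 4 q ^ 3 * J 16 q))"
proof -
  note nz = J_nonzero[OF q(1)]
  note s0 = square_minus_one[OF s]
  note tx = theta_prod_sqrt_imag[OF assms]
  have s': "(- s)\<^sup>2 = - 1" using s by simp
  have Y: "- q * (x * q)\<^sup>2 = - s * q ^ 4"
    unfolding power_mult_distrib x by (simp add: eval_nat_numeral)
  have T: "theta_prod (- s * q ^ 4) (q ^ 4) = - s * (1 + s) * (J 16 q / J 8 q)"
    using theta_prod_imag_shift[OF q s', of 4] by simp
  have tx': "theta_prod (x * q) q = - theta_prod x q / x" "theta_prod (- (x * q)) q = theta_prod (- x) q / x"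
    using theta_prod_shift[OF q tx(2)] theta_prod_shift[OF q, of "- x"] tx(2) by auto
  have TT: "theta_prod (x * q) q * theta_prod (- (x * q)) q = s / q * (J 4 q ^ 2 / (J 2 q * J 8 q))"
  proof -
    have "theta_prod (x * q) q * theta_prod (- (x * q)) q = - (theta_prod x q * theta_prod (- x) q) / x\<^sup>2"
      unfolding tx' by (simp add: power2_eq_square)
    also have "\<dots> = - (1 / s) / q * (J 4 q ^ 2 / (J 2 q * J 8 q))"
      unfolding tx(1) x by simp
    finally show ?thesis by (simp add: s0(2))
  qed
  have "(g (x * q) q + g (- (x * q)) q) / 2 = - q * g (- s * q ^ 4) (q ^ 4) +
      J 2 q ^ 4 / (J 1 q ^ 2 * J 4 q) /
      (s / q * (J 4 q ^ 2 / (J 2 q * J 8 q)) * (- s * (1 + s) * (J 16 q / J 8 q)))"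
    using g_bisection[OF q, of "x * q"] nz tx q s0 unfolding Y T TT by (simp add: tx')
  also have "s / q * (J 4 q ^ 2 / (J 2 q * J 8 q)) * (- s * (1 + s) * (J 16 q / J 8 q))
      = (1 + s) / q * (J 4 q ^ 2 / (J 2 q * J 8 q)) * (J 16 q / J 8 q) * - (s\<^sup>2)"
    by (simp add: power2_eq_square)
  also have "J 2 q ^ 4 / (J 1 q ^ 2 * J 4 q) / \<dots> =
      1 / (1 + s) * (q * J 2 q ^ 5 * J 8 q ^ 2 / (J 1 q ^ 2 * J 4 q ^ 3 * J 16 q))"
    unfolding s using nz[of 1] nz[of 2] nz[of 4] nz[of 8] nz[of 16] q s0(3)
    by (simp add: divide_simps) algebra
  finally show ?thesis by simp
qed

lemma g_bisection_imag_shift: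
  assumes q: "norm q < 1" "q \<noteq> 0"
  shows "(g (\<i> * q ^ 4) (q ^ 4) + g (- \<i> * q ^ 4) (q ^ 4)) / 2 =
    - (q ^ 4) * g (q ^ 4) (q ^ 16) + J 8 q ^ 7 / (2 * J 4 q ^ 3 * J 16 q ^ 3)"
proof -
  note nz = J_nonzero[OF q(1)]
  have q4: "norm (q ^ 4) < 1" "q ^ 4 \<noteq> 0" "norm (q ^ 16) < 1" "q ^ 16 \<noteq> 0"
    using q by (auto intro: norm_power_less_one)
  have t: "theta_prod (\<i> * q ^ 4) (q ^ 4) = \<i> * (1 - \<i>) * (J 16 q / J 8 q)"
    "theta_prod (- (\<i> * q ^ 4)) (q ^ 4) = - \<i> * (1 + \<i>) * (J 16 q / J 8 q)"
    using theta_prod_imag_shift[OF q, of \<i> 4] theta_prod_imag_shift[OF q, of "- \<i>" 4] by simp_all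
  have tt: "theta_prod (\<i> * q ^ 4) (q ^ 4) * theta_prod (- (\<i> * q ^ 4)) (q ^ 4) = 2 * (J 16 q / J 8 q) ^ 2"
    unfolding t by (simp add: field_simps power2_eq_square)
  have Y: "- (q ^ 4) * (\<i> * q ^ 4)\<^sup>2 = q ^ 12"
    by (simp add: power_mult_distrib power_mult[symmetric] power_add[symmetric])
  have e: "q ^ 16 / q ^ 12 = q ^ 4" "q ^ 16 / q ^ 4 = q ^ 12"
    using q by (simp_all add: power_diff[symmetric])
  have T: "theta_prod (q ^ 12) (q ^ 16) = J 4 q / J 8 q"
    using qpoch_inf_bisect[of "q ^ 8" "q ^ 4"] norm_power_less_one[OF q(1), of 8] qpoch_inf_odd_J[OF q(1), of 4]
    by (simp add: theta_prod_def e power_mult[symmetric] power_add[symmetric] mult.commute)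
  \<comment> \<open>The bisection produces the argument \<open>q ^ 12\<close>; the symmetry
    \<open>x \<mapsto> q ^ 16 / x\<close> replaces it by \<open>q ^ 4\<close>.\<close>
  have G: "g (q ^ 12) (q ^ 16) = g (q ^ 4) (q ^ 16)"
    using g_reflect[OF q4(3,4), of "q ^ 12"] T nz[of 4] nz[of 8] q by (simp add: e)
  have i: "1 - \<i> \<noteq> 0" "1 + \<i> \<noteq> 0"
    by (auto simp: complex_eq_iff)
  have "(g (\<i> * q ^ 4) (q ^ 4) + g (- (\<i> * q ^ 4)) (q ^ 4)) / 2 = - (q ^ 4) * g (q ^ 12) (q ^ 16) +
     J 8 q ^ 4 / (J 4 q ^ 2 * J 16 q) / (2 * (J 16 q / J 8 q) ^ 2 * (J 4 q / J 8 q))"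
  proof -
    have "(q ^ 4) ^ 4 = q ^ 16" by (simp add: power_mult[symmetric])
    moreover have "theta_prod (\<i> * q ^ 4) (q ^ 4) \<noteq> 0" "theta_prod (- (\<i> * q ^ 4)) (q ^ 4) \<noteq> 0"
      unfolding t using nz i by simp_all
    ultimately show ?thesis
      using g_bisection[OF q4(1,2), of "\<i> * q ^ 4"] nz[of 4] nz[of 8] q
      unfolding Y tt by (simp add: J_power T)
  qed
  also have "J 8 q ^ 4 / (J 4 q ^ 2 * J 16 q) / (2 * (J 16 q / J 8 q) ^ 2 * (J 4 q / J 8 q))
     = J 8 q ^ 7 / (2 * J 4 q ^ 3 * J 16 q ^ 3)"
    using nz[of 4] nz[of 8] nz[of 16]
    by (simp add: divide_simps) algebra
  finally show ?thesis
    by (simp add: G)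
qed

text \<open>By the functional equation, \<open>x ^ 3 * (g x q - g (- x) q)\<close> is, up to sign
  and polynomial terms, the even average at \<open>x * q\<close>. The linear terms cancel between
  \<open>x\<close> and \<open>- x\<close>, the quadratic ones because
  \<open>x^2 + y^2 = 0\<close>.\<close>

lemma g_quadrisection_shift:
  assumes q: "norm q < 1" "q \<noteq> 0" and x: "x\<^sup>2 = \<i> * q" and y: "y\<^sup>2 = - \<i> * q"
  shows "- (x ^ 3 * (g x q - g (- x) q) + y ^ 3 * (g y q - g (- y) q)) / 4 =
    q ^ 5 * g (q ^ 4) (q ^ 16) + q\<^sup>2 * (J 8 q * J 16 q / J 4 q)"
proof -
  note nz = J_nonzero[OF q(1)]
  define C where "C = q * J 2 q ^ 5 * J 8 q ^ 2 / (J 1 q ^ 2 * J 4 q ^ 3 * J 16 q)"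
  have "C = J 2 q ^ 5 / (J 1 q ^ 2 * J 4 q ^ 2) * (q * J 8 q ^ 2 / (J 4 q * J 16 q))"
    by (simp add: C_def power2_eq_square power3_eq_cube mult_ac)
  also have "\<dots> = q * J 8 q ^ 7 / (J 4 q ^ 3 * J 16 q ^ 3) + 2 * q\<^sup>2 * (J 8 q * J 16 q / J 4 q)"
    unfolding phi_bisection[OF q] using nz[of 4] nz[of 8] nz[of 16]
    by (simp add: divide_simps) algebra
  finally have C: "C = q * J 8 q ^ 7 / (J 4 q ^ 3 * J 16 q ^ 3) + 2 * q\<^sup>2 * (J 8 q * J 16 q / J 4 q)" .
  have i: "\<i>\<^sup>2 = (- 1 :: complex)" "(- \<i>)\<^sup>2 = (- 1 :: complex)" by simp_all
  note tx = theta_prod_sqrt_imag[OF q i(1) x] and ty = theta_prod_sqrt_imag[OF q i(2) y]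
  have 1: "(g (x * q) q + g (- x * q) q) / 2 = - q * g (- \<i> * q ^ 4) (q ^ 4) + 1 / (1 + \<i>) * C"
    unfolding C_def by (rule g_bisection_sqrt_imag_shift[OF q i(1) x])
  have 2: "(g (y * q) q + g (- y * q) q) / 2 = - q * g (\<i> * q ^ 4) (q ^ 4) + 1 / (1 - \<i>) * C"
    using g_bisection_sqrt_imag_shift[OF q i(2) y] by (simp add: C_def)
  have i': "1 / (1 + \<i>) + 1 / (1 - \<i>) = 1"
    by (simp add: complex_eq_iff Re_divide Im_divide)
  have sh: "g (x * q) q = - (x ^ 3 * g x q) - x - x\<^sup>2" "g (- x * q) q = x ^ 3 * g (- x) q + x - x\<^sup>2"
    "g (y * q) q = - (y ^ 3 * g y q) - y - y\<^sup>2" "g (- y * q) q = y ^ 3 * g (- y) q + y - y\<^sup>2"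
    using g_shift[OF q tx(2,3)] g_shift[OF q, of "- x"] g_shift[OF q ty(2,3)] g_shift[OF q, of "- y"] tx ty
    by auto
  have "(g (x * q) q + g (- x * q) q) / 2 + (g (y * q) q + g (- y * q) q) / 2 =
      - (x ^ 3 * (g x q - g (- x) q) + y ^ 3 * (g y q - g (- y) q)) / 2 - (x\<^sup>2 + y\<^sup>2)"
    unfolding sh by (simp add: field_simps)
  also have "x\<^sup>2 + y\<^sup>2 = 0" by (simp add: x y)
  finally have halves: "(g (x * q) q + g (- x * q) q) / 2 + (g (y * q) q + g (- y * q) q) / 2 =
      - (x ^ 3 * (g x q - g (- x) q) + y ^ 3 * (g y q - g (- y) q)) / 2 - 0" .
  have "- (x ^ 3 * (g x q - g (- x) q) + y ^ 3 * (g y q - g (- y) q)) / 4 =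
      ((g (x * q) q + g (- x * q) q) / 2 + (g (y * q) q + g (- y * q) q) / 2) / 2"
    unfolding halves by simp
  also have "\<dots> = - q * ((g (\<i> * q ^ 4) (q ^ 4) + g (- \<i> * q ^ 4) (q ^ 4)) / 2)
      + (1 / (1 + \<i>) + 1 / (1 - \<i>)) * C / 2"
    unfolding 1 2 by (simp add: algebra_simps add_divide_distrib diff_divide_distrib)
  also have "\<dots> = - q * (- (q ^ 4) * g (q ^ 4) (q ^ 16) + J 8 q ^ 7 / (2 * J 4 q ^ 3 * J 16 q ^ 3)) + C / 2"
    unfolding g_bisection_imag_shift[OF q] i' by simp
  also have "\<dots> = q ^ 5 * g (q ^ 4) (q ^ 16) + q\<^sup>2 * (J 8 q * J 16 q / J 4 q)"
    unfolding C by (simp add: algebra_simps eval_nat_numeral)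
  finally show ?thesis .
qed

subsection \<open>Generating function of the odd rank\<close>

text \<open>With the strict bound \<open>2 * D\<close>, a row of a symbol with subscript
  \<open>D\<close> lies in \<open>odd_rows (Suc D)\<close>, and an induction on the bound can start
  from the empty row alone.\<close>

definition odd_rows :: "nat \<Rightarrow> nat list set" where
  "odd_rows D = {xs. sorted_wrt (\<ge>) xs \<and> (\<forall>x\<in>set xs. odd x \<and> x < 2 * D)}"

lemma odd_rows_0: "odd_rows 0 = {[]}"
  by (auto simp: odd_rows_def)

lemma dropWhile_in_odd_rows:
  assumes "ys \<in> odd_rows (Suc D)"
  shows "dropWhile (\<lambda>x. x = 2 * D + 1) ys \<in> odd_rows D"
proof -
  let ?zs = "dropWhile (\<lambda>x. x = 2 * D + 1) ys"
  have sorted: "sorted_wrt (\<ge>) ?zs"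
    using assms by (auto simp: odd_rows_def dropWhile_eq_drop sorted_wrt_drop)
  have mem: "odd x \<and> x < 2 * Suc D" if "x \<in> set ?zs" for x
    using assms set_dropWhileD[OF that] by (auto simp: odd_rows_def)
  have "x < 2 * D" if x: "x \<in> set ?zs" for x
  proof -
    obtain y zs where zs: "?zs = y # zs"
      by (metis list.set_cases x)
    have "y \<noteq> 2 * D + 1"
      using hd_dropWhile[of "\<lambda>x. x = 2 * D + 1" ys] unfolding zs by simp
    with mem[of y] zs have "y < 2 * D"
      by (auto elim!: oddE)
    moreover have "x \<le> y"
      using sorted x zs by auto
    ultimately show ?thesis by simp
  qed
  with sorted mem show ?thesis
    by (auto simp: odd_rows_def)
qed

text \<open>A non-increasing row carries all copies of the largest admissible entry at its front.
  Their number is free, which contributes one geometric series, that is, one factor of the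
  denominator \<open>qpoch\<close>.\<close>

lemma bij_betw_odd_rows_Suc:
  "bij_betw (\<lambda>(m, xs). replicate m (2 * D + 1) @ xs) (UNIV \<times> odd_rows D) (odd_rows (Suc D))"
proof (rule bij_betwI[where g = "\<lambda>ys. (length (takeWhile (\<lambda>x. x = 2 * D + 1) ys),
    dropWhile (\<lambda>x. x = 2 * D + 1) ys)"])
  show "(\<lambda>(m, xs). replicate m (2 * D + 1) @ xs) \<in> UNIV \<times> odd_rows D \<rightarrow> odd_rows (Suc D)"
  proof safe
    fix m :: nat and xs assume xs: "xs \<in> odd_rows D"
    have "sorted_wrt (\<ge>) (replicate m (2 * D + 1))"
      by (induction m) auto
    moreover have "x < 2 * D" if "x \<in> set xs" for x
      using xs that by (simp add: odd_rows_def)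
    ultimately show "replicate m (2 * D + 1) @ xs \<in> odd_rows (Suc D)"
      using xs by (force simp: odd_rows_def sorted_wrt_append)
  qed
  show "(\<lambda>ys. (length (takeWhile (\<lambda>x. x = 2 * D + 1) ys), dropWhile (\<lambda>x. x = 2 * D + 1) ys))
      \<in> odd_rows (Suc D) \<rightarrow> UNIV \<times> odd_rows D"
    using dropWhile_in_odd_rows by auto
next
  fix z :: "nat \<times> nat list"
  assume z: "z \<in> UNIV \<times> odd_rows D"
  obtain m xs where mxs: "z = (m, xs)" by (cases z)
  have "x \<noteq> 2 * D + 1" if "x \<in> set xs" for x
    using z that by (auto simp: mxs odd_rows_def)
  then have xs: "takeWhile (\<lambda>x. x = 2 * D + 1) xs = []" "dropWhile (\<lambda>x. x = 2 * D + 1) xs = xs"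
    by (cases xs; auto)+
  then have "takeWhile (\<lambda>x. x = 2 * D + 1) (replicate m (2 * D + 1) @ xs) = replicate m (2 * D + 1)"
    "dropWhile (\<lambda>x. x = 2 * D + 1) (replicate m (2 * D + 1) @ xs) = xs"
    by (subst takeWhile_append2 dropWhile_append2; auto)+
  then show "(length (takeWhile (\<lambda>x. x = 2 * D + 1) (case z of (m, xs) \<Rightarrow> replicate m (2 * D + 1) @ xs)),
      dropWhile (\<lambda>x. x = 2 * D + 1) (case z of (m, xs) \<Rightarrow> replicate m (2 * D + 1) @ xs)) = z"
    by (simp add: mxs)
next
  fix ys :: "nat list"
  have "replicate (length (takeWhile (\<lambda>x. x = 2 * D + 1) ys)) (2 * D + 1) = takeWhile (\<lambda>x. x = 2 * D + 1) ys"
    by (intro replicate_length_same) (auto dest: set_takeWhileD)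
  then show "(case (length (takeWhile (\<lambda>x. x = 2 * D + 1) ys), dropWhile (\<lambda>x. x = 2 * D + 1) ys) of
      (m, xs) \<Rightarrow> replicate m (2 * D + 1) @ xs) = ys"
    by simp
qed

lemma norm_mult_less_one:
  fixes z p :: complex
  assumes "norm z \<le> 1" "norm p < 1"
  shows "norm (z * p) < 1"
  using assms mult_left_le_one_le[of "norm p" "norm z"] by (simp add: norm_mult)

lemma has_sum_odd_rows:
  fixes z p :: complex
  assumes z: "norm z \<le> 1" and p: "norm p < 1"
  shows "((\<lambda>xs. z ^ length xs * p ^ sum_list xs) has_sum (1 / qpoch (z * p) (p\<^sup>2) D)) (odd_rows D)"
proof (induction D)
  case 0
  show ?case unfolding odd_rows_0 by (rule has_sum_finiteI) auto
next
  case (Suc D)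
  define c where "c = z * p * (p\<^sup>2) ^ D"
  have c_eq: "c = z * p ^ (2 * D + 1)"
    by (simp add: c_def power_mult)
  have c: "norm c < 1"
    unfolding c_eq using z p by (intro norm_mult_less_one norm_power_less_one) auto
  have "((\<lambda>m. c ^ m) has_sum (1 / (1 - c))) UNIV"
    using c by (intro norm_summable_imp_has_sum geometric_sums) (auto simp: norm_power)
  from has_sum_product[OF this Suc.IH]
  have "((\<lambda>(m, xs). c ^ m * (z ^ length xs * p ^ sum_list xs)) has_sum
      (1 / (1 - c) * (1 / qpoch (z * p) (p\<^sup>2) D))) (UNIV \<times> odd_rows D)" .
  moreover have "(\<lambda>(m, xs). c ^ m * (z ^ length xs * p ^ sum_list xs)) =
      (\<lambda>y. (\<lambda>xs. z ^ length xs * p ^ sum_list xs) ((\<lambda>(m, xs). replicate m (2 * D + 1) @ xs) y))"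
    by (auto simp: fun_eq_iff c_eq power_add power_mult_distrib power_mult[symmetric] sum_list_replicate mult_ac)
  ultimately have "((\<lambda>xs. z ^ length xs * p ^ sum_list xs) has_sum
      (1 / (1 - c) * (1 / qpoch (z * p) (p\<^sup>2) D))) (odd_rows (Suc D))"
    using has_sum_reindex_bij_betw[OF bij_betw_odd_rows_Suc, of "\<lambda>xs. z ^ length xs * p ^ sum_list xs"] by simp
  then show ?case
    by (simp add: qpoch_Suc c_def mult.commute)
qed

text \<open>The exponent of \<open>z\<close> is the odd rank and that of \<open>p\<close> the number
  represented; the powers are grouped by row so that the sum over both rows factors.\<close>

definition symbol_weight :: "complex \<Rightarrow> complex \<Rightarrow> nat \<times> nat list \<times> nat list \<Rightarrow> complex" where
  "symbol_weight z p = (\<lambda>(D, xs, ys).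
     p ^ (2 * D\<^sup>2 + 2 * D + 1) * ((z ^ length xs * p ^ sum_list xs) * (inverse z ^ length ys * p ^ sum_list ys)))"

abbreviation symbol_set :: "(nat \<times> nat list \<times> nat list) set" where
  "symbol_set \<equiv> Sigma UNIV (\<lambda>D. odd_rows (Suc D) \<times> odd_rows (Suc D))"

lemma has_sum_symbol_weight_fixed:
  assumes z: "norm z = 1" and p: "norm p < 1" and p0: "p \<noteq> 0"
  shows "((\<lambda>S. symbol_weight z p (D, S)) has_sum
    (p * ((p\<^sup>2) ^ (D * (D + 1)) / (qpoch (z * p) (p\<^sup>2) (D + 1) * qpoch (p\<^sup>2 / (z * p)) (p\<^sup>2) (D + 1)))))
    (odd_rows (Suc D) \<times> odd_rows (Suc D))"
proof -
  have e: "p\<^sup>2 / (z * p) = inverse z * p"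
    using p0 by (simp add: power2_eq_square field_simps)
  have e2: "p ^ (2 * D\<^sup>2 + 2 * D + 1) = p * (p\<^sup>2) ^ (D * (D + 1))"
  proof -
    have "2 * D\<^sup>2 + 2 * D + 1 = Suc (2 * (D * (D + 1)))"
      by (simp add: power2_eq_square)
    then show ?thesis by (simp only: power_Suc power_mult)
  qed
  have wt: "(\<lambda>S. symbol_weight z p (D, S)) = (\<lambda>S. p ^ (2 * D\<^sup>2 + 2 * D + 1) *
      (case S of (xs, ys) \<Rightarrow> (z ^ length xs * p ^ sum_list xs) * (inverse z ^ length ys * p ^ sum_list ys)))"
    by (auto simp: symbol_weight_def)
  have "((\<lambda>(xs, ys). (z ^ length xs * p ^ sum_list xs) * (inverse z ^ length ys * p ^ sum_list ys)) has_sum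
      (1 / qpoch (z * p) (p\<^sup>2) (Suc D) * (1 / qpoch (inverse z * p) (p\<^sup>2) (Suc D))))
      (odd_rows (Suc D) \<times> odd_rows (Suc D))"
    using z p by (intro has_sum_product has_sum_odd_rows) (auto simp: norm_inverse)
  from has_sum_cmult_right[OF this, of "p ^ (2 * D\<^sup>2 + 2 * D + 1)"] show ?thesis
    unfolding e by (simp only: wt e2) (simp add: case_prod_unfold)
qed

lemma theta_prod_unit_circle_nonzero:
  assumes z: "norm z = 1" and p: "norm p < 1" and p0: "p \<noteq> 0"
  shows "theta_prod (z * p) (p\<^sup>2) \<noteq> 0"
proof (rule theta_prod_nonzero)
  show "norm (p\<^sup>2) < 1" using p by (intro norm_power_less_one) auto
  show "norm (z * p) < 1" "norm (p\<^sup>2 / (z * p)) < 1"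
    using z p p0 by (simp_all add: norm_mult norm_divide power2_eq_square)
qed

lemma symbol_weight_sums:
  assumes z: "norm z = 1" and p: "norm p < 1" and p0: "p \<noteq> 0"
  shows "(\<lambda>D. p * ((p\<^sup>2) ^ (D * (D + 1)) /
    (qpoch (z * p) (p\<^sup>2) (D + 1) * qpoch (p\<^sup>2 / (z * p)) (p\<^sup>2) (D + 1)))) sums (p * g (z * p) (p\<^sup>2))"
proof -
  have p2: "norm (p\<^sup>2) < 1" using p by (intro norm_power_less_one) auto
  note nz = theta_prod_unit_circle_nonzero[OF assms]
  have "g (z * p) (p\<^sup>2) = g_num (z * p) (p\<^sup>2) / theta_prod (z * p) (p\<^sup>2)"
    using z p0 nz by (intro g_conv_g_num p2) auto
  then show ?thesis
    using sums_mult[OF g_num_sums[OF p2 nz], of p] by simp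
qed

lemma has_sum_symbol_weight:
  assumes z: "norm z = 1" and p: "norm p < 1" and p0: "p \<noteq> 0"
  shows "(symbol_weight z p has_sum (p * g (z * p) (p\<^sup>2))) symbol_set"
proof -
  define h where "h = (\<lambda>z p D. p * ((p\<^sup>2) ^ (D * (D + 1)) /
    (qpoch (z * p) (p\<^sup>2) (D + 1) * qpoch (p\<^sup>2 / (z * p)) (p\<^sup>2) (D + 1))))"
  have inner: "((\<lambda>S. symbol_weight z p (D, S)) has_sum h z p D) (odd_rows (Suc D) \<times> odd_rows (Suc D))"
    if "norm z = 1" "norm p < 1" "p \<noteq> 0" for z p D
    unfolding h_def using that by (rule has_sum_symbol_weight_fixed)
  have outer: "h z p sums (p * g (z * p) (p\<^sup>2))" if "norm z = 1" "norm p < 1" "p \<noteq> 0" for z p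
    using symbol_weight_sums[OF that] by (simp add: h_def)
  \<comment> \<open>Summability over all symbols comes from a positive comparison: as
    \<open>norm z = 1\<close>, the norm of a weight at \<open>(z, p)\<close> is the weight at
    \<open>(1, norm p)\<close>, whose iterated sums are already known.\<close>
  define r where "r = complex_of_real (norm p)"
  have r: "norm r < 1" "r \<noteq> 0" using p p0 by (auto simp: r_def)
  have norm_weight: "norm (symbol_weight z p S) = Re (symbol_weight 1 r S)" for S
    by (cases S) (simp add: symbol_weight_def r_def norm_mult norm_power norm_inverse z flip: of_real_power of_real_mult)
  have real_inner: "((\<lambda>S. norm (symbol_weight z p (D, S))) has_sum Re (h 1 r D))
      (odd_rows (Suc D) \<times> odd_rows (Suc D))" for D
    unfolding norm_weight using has_sum_Re[OF inner[of 1 r D]] r by simp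
  have "(\<lambda>D. Re (h 1 r D)) summable_on UNIV"
  proof (rule summable_nonneg_imp_summable_on)
    show "summable (\<lambda>D. Re (h 1 r D))"
      using sums_Re[OF outer[of 1 r]] r by (auto simp: sums_iff)
    show "0 \<le> Re (h 1 r D)" for D
      by (rule has_sum_nonneg[OF real_inner]) auto
  qed
  then have "(\<lambda>S. norm (symbol_weight z p S)) summable_on symbol_set"
    using real_inner by (intro summable_on_SigmaI) auto
  then have summ: "symbol_weight z p summable_on symbol_set"
    by (rule abs_summable_summable)
  define V where "V = infsum (symbol_weight z p) symbol_set"
  have V: "(symbol_weight z p has_sum V) symbol_set"
    unfolding V_def using summ by (rule has_sum_infsum)
  have "(h z p has_sum V) UNIV"
    by (rule has_sum_SigmaD[OF V]) (rule inner[OF assms])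
  then have "h z p sums V"
    by (rule has_sum_imp_sums)
  with outer[OF assms] have "V = p * g (z * p) (p\<^sup>2)"
    by (simp add: sums_unique2)
  with V show ?thesis by simp
qed

lemma odd_Durfee_symbols_eq:
  "odd_Durfee_symbols n = {(D, xs, ys). (D, xs, ys) \<in> symbol_set \<and>
     n = sum_list xs + sum_list ys + 2 * D\<^sup>2 + 2 * D + 1}"
  by (auto simp: odd_Durfee_symbols_def odd_rows_def less_Suc_eq_le)

lemma symbol_weight_eq:
  assumes "S \<in> odd_Durfee_symbols n" "z \<noteq> 0"
  shows "symbol_weight z p S = z powi odd_rank S * p ^ n"
proof -
  obtain D xs ys where S: "S = (D, xs, ys)" by (cases S)
  have "n = sum_list xs + sum_list ys + 2 * D\<^sup>2 + 2 * D + 1"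
    using assms by (auto simp: S odd_Durfee_symbols_def)
  then show ?thesis
    using assms(2) by (simp add: S symbol_weight_def power_int_diff power_add field_simps)
qed

theorem odd_rank_generating_function:
  assumes z: "norm z = 1" and p: "norm p < 1" and p0: "p \<noteq> 0"
  shows "(\<lambda>n. (\<Sum>S\<in>odd_Durfee_symbols n. z powi odd_rank S) * p ^ n) sums (p * g (z * p) (p\<^sup>2))"
proof -
  define size where "size = (\<lambda>(D, xs, ys). sum_list xs + sum_list ys + 2 * D\<^sup>2 + 2 * D + (1::nat))"
  \<comment> \<open>A symbol determines the number it represents, so the sum over symbols may be
    regrouped by that number.\<close>
  have "bij_betw snd (Sigma UNIV odd_Durfee_symbols) symbol_set"
    by (rule bij_betwI[where g = "\<lambda>S. (size S, S)"]) (auto simp: odd_Durfee_symbols_eq size_def)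
  from has_sum_reindex_bij_betw[OF this] has_sum_symbol_weight[OF assms]
  have "((\<lambda>y. symbol_weight z p (snd y)) has_sum (p * g (z * p) (p\<^sup>2))) (Sigma UNIV odd_Durfee_symbols)"
    by blast
  then have "((\<lambda>n. \<Sum>S\<in>odd_Durfee_symbols n. symbol_weight z p S) has_sum (p * g (z * p) (p\<^sup>2))) UNIV"
    by (rule has_sum_SigmaD) (auto intro: has_sum_finite finite_odd_Durfee_symbols)
  moreover have "z \<noteq> 0" using z by auto
  ultimately show ?thesis
    by (intro has_sum_imp_sums) (simp add: symbol_weight_eq sum_distrib_right)
qed

section \<open>Root of unity filters modulo 8\<close>

lemma powi_mod_8:
  fixes z :: complex
  assumes "z ^ 8 = 1"
  shows "z powi r = z ^ nat (r mod 8)"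
proof -
  have z0: "z \<noteq> 0" using assms by auto
  have "z powi r = z powi (8 * (r div 8) + r mod 8)" by simp
  also have "\<dots> = (z powi 8) powi (r div 8) * z powi (r mod 8)"
    by (simp only: power_int_add[OF disjI1[OF z0]] power_int_mult)
  also have "\<dots> = z ^ nat (r mod 8)"
    using assms by (simp add: power_int_def[of z "r mod 8"])
  finally show ?thesis .
qed

text \<open>The four bases are the primitive eighth roots of unity, so the sum of powers is the
  Ramanujan sum modulo 8, with the values 4, -4 and 0.\<close>

lemma eighth_root_filter:
  fixes w :: complex
  assumes w: "w\<^sup>2 = \<i>"
  shows "(w powi r + (- w) powi r + (\<i> * w) powi r + (- (\<i> * w)) powi r) / 4 =
      (if [r = 0] (mod 8) then 1 else if [r = 4] (mod 8) then - 1 else 0)"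
proof -
  have w4: "w ^ 4 = - 1"
    using w by (metis i_squared power2_eq_square power4_eq_xxxx mult.assoc)
  have w8: "w ^ 8 = 1"
    using power_mult[of w 4 2] w4 by simp
  have ws: "w ^ 3 = \<i> * w" "w ^ 5 = - w" "w ^ 6 = - \<i>" "w ^ 7 = - (\<i> * w)"
  proof -
    have "w ^ 3 = w\<^sup>2 * w" "w ^ 5 = w ^ 4 * w" "w ^ 6 = w ^ 4 * w\<^sup>2" "w ^ 7 = w ^ 4 * (w\<^sup>2 * w)"
      by (simp_all add: eval_nat_numeral)
    then show "w ^ 3 = \<i> * w" "w ^ 5 = - w" "w ^ 6 = - \<i>" "w ^ 7 = - (\<i> * w)"
      unfolding w w4 by simp_all
  qed
  have ipow: "\<i> ^ 3 = - \<i>" "\<i> ^ 4 = 1" "\<i> ^ 5 = \<i>" "\<i> ^ 6 = - 1" "\<i> ^ 7 = - \<i>" "\<i> ^ 8 = 1"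
    by (simp_all add: eval_nat_numeral)
  have eighth: "(- w) ^ 8 = 1" "(\<i> * w) ^ 8 = 1" "(- (\<i> * w)) ^ 8 = 1"
    by (simp_all add: w8 ipow power_mult_distrib)
  have "0 \<le> r mod 8" "r mod 8 < 8" by simp_all
  then consider "r mod 8 = 0" | "r mod 8 = 1" | "r mod 8 = 2" | "r mod 8 = 3"
    | "r mod 8 = 4" | "r mod 8 = 5" | "r mod 8 = 6" | "r mod 8 = 7" by linarith
  then show ?thesis
    unfolding powi_mod_8[OF w8] powi_mod_8[OF eighth(1)] powi_mod_8[OF eighth(2)]
      powi_mod_8[OF eighth(3)] cong_def
    by cases (simp_all add: w w4 ws ipow power_mult_distrib)
qed

text \<open>The cubic weight raises the exponent to \<open>r + 3\<close>; its oddness produces the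
  minus signs at \<open>- w\<close> and \<open>- (\<i> * w)\<close>. The previous filter then
  detects \<open>r + 3\<close> at 0 and 4, that is \<open>r\<close> at 5 and 1.\<close>

lemma eighth_root_filter_shift:
  fixes w :: complex
  assumes w: "w\<^sup>2 = \<i>"
  shows "- (w ^ 3 * (w powi r - (- w) powi r) + (\<i> * w) ^ 3 * ((\<i> * w) powi r - (- (\<i> * w)) powi r)) / 4 =
      (if [r = 1] (mod 8) then 1 else if [r = 5] (mod 8) then - 1 else 0)"
proof -
  have shift: "z powi (r + 3) = z ^ 3 * z powi r" if "z \<noteq> 0" for z :: complex
    using that by (simp add: power_int_add)
  have w0: "w \<noteq> 0" using w by auto
  have sh: "w powi (r + 3) = w ^ 3 * w powi r" "(- w) powi (r + 3) = - (w ^ 3 * (- w) powi r)"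
    "(\<i> * w) powi (r + 3) = (\<i> * w) ^ 3 * (\<i> * w) powi r"
    "(- (\<i> * w)) powi (r + 3) = - ((\<i> * w) ^ 3 * (- (\<i> * w)) powi r)"
    using shift[of w] shift[of "- w"] shift[of "\<i> * w"] shift[of "- (\<i> * w)"] w0 by simp_all
  have "- (w ^ 3 * (w powi r - (- w) powi r) + (\<i> * w) ^ 3 * ((\<i> * w) powi r - (- (\<i> * w)) powi r)) / 4
      = - ((w powi (r + 3) + (- w) powi (r + 3) + (\<i> * w) powi (r + 3) + (- (\<i> * w)) powi (r + 3)) / 4)"
  proof -
    have num: "w ^ 3 * (w powi r - (- w) powi r) + (\<i> * w) ^ 3 * ((\<i> * w) powi r - (- (\<i> * w)) powi r)
        = w powi (r + 3) + (- w) powi (r + 3) + (\<i> * w) powi (r + 3) + (- (\<i> * w)) powi (r + 3)"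
      unfolding sh by (simp add: algebra_simps)
    show ?thesis
      unfolding num by (rule minus_divide_left[symmetric])
  qed
  also have "\<dots> = - (if [r + 3 = 0] (mod 8) then 1 else if [r + 3 = 4] (mod 8) then - 1 else 0)"
    by (simp only: eighth_root_filter[OF w])
  also have "\<dots> = (if [r = 1] (mod 8) then 1 else if [r = 5] (mod 8) then - 1 else 0)"
  proof -
    have "r + 3 - 0 = (r - 5) + 8" "r + 3 - 4 = r - 1"
      by simp_all
    then have "[r + 3 = 0] (mod 8) \<longleftrightarrow> [r = 5] (mod 8)" "[r + 3 = 4] (mod 8) \<longleftrightarrow> [r = 1] (mod 8)"
      unfolding cong_iff_dvd_diff by (simp_all only: dvd_add_triv_right_iff)
    moreover have "\<not> ([r = 1] (mod 8) \<and> [r = 5] (mod 8))"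
      by (auto simp: cong_def)
    ultimately show ?thesis by simp
  qed
  finally show ?thesis .
qed

subsection \<open>Sections modulo 8\<close>

lemma N0_eq_sum: "N0 a M n = (\<Sum>S\<in>odd_Durfee_symbols n. if [odd_rank S = a] (mod M) then 1 else 0)"
  unfolding N0_def card_eq_sum by (rule sum.inter_filter) (rule finite_odd_Durfee_symbols)

text \<open>Exchanging the two rows negates the odd rank, and \<open>- 3\<close> is congruent to 5
  modulo 8.\<close>

lemma N0_5_eq_N0_3: "N0 5 8 n = N0 3 8 n"
  unfolding N0_def
proof (rule bij_betw_same_card)
  have c: "[- r = 3] (mod 8) \<longleftrightarrow> [r = 5] (mod 8)" for r :: int
  proof -
    have "- r - 3 = - ((r - 5) + 8)" by simp
    then show ?thesis
      unfolding cong_iff_dvd_diff by (simp only: dvd_minus_iff dvd_add_triv_right_iff)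
  qed
  have c': "[- r = 5] (mod 8) \<longleftrightarrow> [r = 3] (mod 8)" for r :: int
    using c[of "- r"] by auto
  have r: "[odd_rank (D, xs, ys) = 5] (mod 8) \<Longrightarrow> [odd_rank (D, ys, xs) = 3] (mod 8)"
    "[odd_rank (D, xs, ys) = 3] (mod 8) \<Longrightarrow> [odd_rank (D, ys, xs) = 5] (mod 8)" for D xs ys
    using c[of "odd_rank (D, xs, ys)"] c'[of "odd_rank (D, xs, ys)"] by simp_all
  show "bij_betw (\<lambda>(D, xs, ys). (D, ys, xs)) {S \<in> odd_Durfee_symbols n. [odd_rank S = 5] (mod 8)}
      {S \<in> odd_Durfee_symbols n. [odd_rank S = 3] (mod 8)}"
    by (rule bij_betwI[where g = "\<lambda>(D, xs, ys). (D, ys, xs)"])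
       (auto simp: odd_Durfee_symbols_def intro: r simp del: odd_rank.simps)
qed

definition rank_diff_0_4 :: "nat \<Rightarrow> complex" where
  "rank_diff_0_4 n = of_int (int (N0 0 8 n) - int (N0 4 8 n))"

definition rank_diff_1_3 :: "nat \<Rightarrow> complex" where
  "rank_diff_1_3 n = of_int (int (N0 1 8 n) - int (N0 3 8 n))"

lemma exclusive_if_sum:
  fixes P Q :: "'a \<Rightarrow> bool"
  assumes "\<And>S. P S \<Longrightarrow> \<not> Q S"
  shows "(\<Sum>S\<in>A. if P S then 1 else if Q S then - 1 else (0::complex)) =
    of_int (int (\<Sum>S\<in>A. if P S then 1 else 0) - int (\<Sum>S\<in>A. if Q S then 1 else 0))"
proof -
  have "(\<Sum>S\<in>A. if P S then 1 else if Q S then - 1 else (0::complex)) =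
      (\<Sum>S\<in>A. of_nat (if P S then 1 else 0) - of_nat (if Q S then 1 else 0))"
    using assms by (intro sum.cong) auto
  also have "\<dots> = of_int (int (\<Sum>S\<in>A. if P S then 1 else 0) - int (\<Sum>S\<in>A. if Q S then 1 else 0))"
    by (simp only: sum_subtractf of_int_diff of_int_of_nat_eq of_nat_sum of_int_sum)
  finally show ?thesis .
qed

lemma rank_diff_0_4_eq:
  "rank_diff_0_4 n = (\<Sum>S\<in>odd_Durfee_symbols n.
     if [odd_rank S = 0] (mod 8) then 1 else if [odd_rank S = 4] (mod 8) then - 1 else 0)"
  unfolding rank_diff_0_4_def N0_eq_sum by (rule exclusive_if_sum[symmetric]) (simp add: cong_def)

lemma rank_diff_1_3_eq:
  "rank_diff_1_3 n = (\<Sum>S\<in>odd_Durfee_symbols n.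
     if [odd_rank S = 1] (mod 8) then 1 else if [odd_rank S = 5] (mod 8) then - 1 else 0)"
  unfolding rank_diff_1_3_def N0_5_eq_N0_3[symmetric] unfolding N0_eq_sum
  by (rule exclusive_if_sum[symmetric]) (simp add: cong_def)

text \<open>With \<open>q = p^2\<close> every eta quotient and every value of \<open>g\<close> that
  is left is a function of \<open>p ^ 8\<close>. The monomials in front, \<open>p\<close> and
  \<open>p ^ 3\<close> in one case, 1 and \<open>p^2\<close> in the other, therefore name the
  exponent classes that occur.\<close>

lemma rank_diff_sums:
  assumes p: "norm p < 1" "p \<noteq> 0"
  shows "(\<lambda>n. rank_diff_0_4 n * p ^ n) sums
      (p * (J 2 (p ^ 8) ^ 4 / (J 1 (p ^ 8) ^ 2 * J 4 (p ^ 8))) +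
       p ^ 3 * (J 4 (p ^ 8) ^ 3 / J 2 (p ^ 8) ^ 2 + p ^ 8 * g ((p ^ 8) ^ 2) ((p ^ 8) ^ 4)))" (is ?A)
    "(\<lambda>n. rank_diff_1_3 n * p ^ n) sums
      (p ^ 8 * g (p ^ 8) ((p ^ 8) ^ 4) + p\<^sup>2 * (J 2 (p ^ 8) * J 4 (p ^ 8) / J 1 (p ^ 8)))" (is ?B)
proof -
  define w where "w = cis (pi / 4)"
  have w: "w\<^sup>2 = \<i>"
    by (simp add: w_def power2_eq_square cis_mult)
  have w1: "norm w = 1" by (simp add: w_def)
  define q where "q = p\<^sup>2"
  have q: "norm q < 1" "q \<noteq> 0"
    using p by (auto simp: q_def intro: norm_power_less_one)
  define x where "x = w * p"
  define y where "y = \<i> * w * p"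
  have xy: "x\<^sup>2 = \<i> * q" "y\<^sup>2 = - \<i> * q"
    by (simp_all add: x_def y_def q_def power_mult_distrib w)
  let ?\<Sigma> = "\<lambda>z n. \<Sum>S\<in>odd_Durfee_symbols n. z powi odd_rank S"
  have gf: "(\<lambda>n. ?\<Sigma> z n * p ^ n) sums (p * g (z * p) q)" if "norm z = 1" for z
    unfolding q_def by (rule odd_rank_generating_function[OF that p])
  have gfs: "(\<lambda>n. ?\<Sigma> w n * p ^ n) sums (p * g x q)" "(\<lambda>n. ?\<Sigma> (- w) n * p ^ n) sums (p * g (- x) q)"
    "(\<lambda>n. ?\<Sigma> (\<i> * w) n * p ^ n) sums (p * g y q)" "(\<lambda>n. ?\<Sigma> (- (\<i> * w)) n * p ^ n) sums (p * g (- y) q)"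
    using gf[of w] gf[of "- w"] gf[of "\<i> * w"] gf[of "- (\<i> * w)"] w1
    by (simp_all add: x_def y_def norm_mult)
  have Js: "J 4 q = J 1 (p ^ 8)" "J 8 q = J 2 (p ^ 8)" "J 16 q = J 4 (p ^ 8)"
    by (simp_all add: q_def J_power)
  have ps: "q ^ 8 = (p ^ 8) ^ 2" "q ^ 16 = (p ^ 8) ^ 4" "q ^ 4 = p ^ 8" "q ^ 5 = p ^ 2 * p ^ 8"
    by (simp_all add: q_def power_mult[symmetric] power_add[symmetric])

  have "(\<lambda>n. (?\<Sigma> w n * p ^ n + ?\<Sigma> (- w) n * p ^ n + ?\<Sigma> (\<i> * w) n * p ^ n + ?\<Sigma> (- (\<i> * w)) n * p ^ n) / 4)
      sums ((p * g x q + p * g (- x) q + p * g y q + p * g (- y) q) / 4)"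
    by (intro sums_divide sums_add gfs)
  moreover have "(?\<Sigma> w n * p ^ n + ?\<Sigma> (- w) n * p ^ n + ?\<Sigma> (\<i> * w) n * p ^ n + ?\<Sigma> (- (\<i> * w)) n * p ^ n) / 4
      = rank_diff_0_4 n * p ^ n" for n
  proof -
    have "rank_diff_0_4 n = (?\<Sigma> w n + ?\<Sigma> (- w) n + ?\<Sigma> (\<i> * w) n + ?\<Sigma> (- (\<i> * w)) n) / 4"
      unfolding rank_diff_0_4_eq eighth_root_filter[OF w, symmetric]
      by (simp only: sum.distrib sum_divide_distrib[symmetric])
    then show ?thesis by (simp only: distrib_right times_divide_eq_left)
  qed
  moreover have "(p * g x q + p * g (- x) q + p * g y q + p * g (- y) q) / 4 =
      p * ((g x q + g (- x) q + g y q + g (- y) q) / 4)"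
    by (simp only: distrib_left times_divide_eq_right)
  ultimately have "(\<lambda>n. rank_diff_0_4 n * p ^ n) sums (p * ((g x q + g (- x) q + g y q + g (- y) q) / 4))"
    by (simp only:)
  moreover have "p * ((g x q + g (- x) q + g y q + g (- y) q) / 4) =
      p * (J 2 (p ^ 8) ^ 4 / (J 1 (p ^ 8) ^ 2 * J 4 (p ^ 8))) +
      p ^ 3 * (J 4 (p ^ 8) ^ 3 / J 2 (p ^ 8) ^ 2 + p ^ 8 * g ((p ^ 8) ^ 2) ((p ^ 8) ^ 4))"
    unfolding g_quadrisection[OF q xy] Js ps
    by (simp add: q_def algebra_simps power3_eq_cube power2_eq_square)
  ultimately show ?A by (simp only:)

  have "(\<lambda>n. - (w ^ 3 * (?\<Sigma> w n * p ^ n - ?\<Sigma> (- w) n * p ^ n) +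
        (\<i> * w) ^ 3 * (?\<Sigma> (\<i> * w) n * p ^ n - ?\<Sigma> (- (\<i> * w)) n * p ^ n)) / 4)
      sums (- (w ^ 3 * (p * g x q - p * g (- x) q) + (\<i> * w) ^ 3 * (p * g y q - p * g (- y) q)) / 4)"
    by (intro sums_divide sums_minus sums_add sums_diff sums_mult gfs)
  moreover have "- (w ^ 3 * (?\<Sigma> w n * p ^ n - ?\<Sigma> (- w) n * p ^ n) +
        (\<i> * w) ^ 3 * (?\<Sigma> (\<i> * w) n * p ^ n - ?\<Sigma> (- (\<i> * w)) n * p ^ n)) / 4
      = rank_diff_1_3 n * p ^ n" for n
  proof -
    have "rank_diff_1_3 n = - (w ^ 3 * (?\<Sigma> w n - ?\<Sigma> (- w) n) + (\<i> * w) ^ 3 * (?\<Sigma> (\<i> * w) n - ?\<Sigma> (- (\<i> * w)) n)) / 4"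
      unfolding rank_diff_1_3_eq eighth_root_filter_shift[OF w, symmetric]
      by (simp only: sum.distrib sum_divide_distrib[symmetric] sum_negf sum_distrib_left[symmetric] sum_subtractf)
    then show ?thesis
      by (simp only: left_diff_distrib[symmetric] mult.assoc[symmetric] distrib_right[symmetric]
          mult_minus_left[symmetric] times_divide_eq_left)
  qed
  \<comment> \<open>The cube \<open>x ^ 3\<close> contains \<open>p ^ 3\<close>, while the
    generating function supplies only one factor \<open>p\<close>; hence the division by
    \<open>p^2\<close>.\<close>
  moreover have "- (w ^ 3 * (p * g x q - p * g (- x) q) + (\<i> * w) ^ 3 * (p * g y q - p * g (- y) q)) / 4
      = - (x ^ 3 * (g x q - g (- x) q) + y ^ 3 * (g y q - g (- y) q)) / 4 / p\<^sup>2"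
  proof -
    have "w ^ 3 * (p * g x q - p * g (- x) q) = x ^ 3 * (g x q - g (- x) q) / p\<^sup>2"
      "(\<i> * w) ^ 3 * (p * g y q - p * g (- y) q) = y ^ 3 * (g y q - g (- y) q) / p\<^sup>2"
      using p by (simp_all add: x_def y_def power_mult_distrib field_simps power2_eq_square power3_eq_cube)
    then show ?thesis by (simp add: add_divide_distrib diff_divide_distrib mult.commute)
  qed
  moreover have "(q ^ 5 * g (q ^ 4) (q ^ 16) + q\<^sup>2 * (J 8 q * J 16 q / J 4 q)) / p\<^sup>2 =
      p ^ 8 * g (p ^ 8) ((p ^ 8) ^ 4) + p\<^sup>2 * (J 2 (p ^ 8) * J 4 (p ^ 8) / J 1 (p ^ 8))"
    unfolding Js ps using p by (simp add: q_def add_divide_distrib power2_eq_square)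
  ultimately show ?B
    by (simp only: g_quadrisection_shift[OF q xy])
qed

text \<open>Half the sum and half the difference of the series at the two square roots
  \<open>p\<close> and \<open>- p\<close> of \<open>q\<close> isolate the even and the odd
  coefficients, while \<open>A\<close> and \<open>B\<close> see only \<open>p^2\<close>.\<close>

lemma bisect_sums:
  fixes e :: "nat \<Rightarrow> complex" and A B :: "complex \<Rightarrow> complex"
  assumes sums: "\<And>p. norm p < 1 \<Longrightarrow> p \<noteq> 0 \<Longrightarrow> (\<lambda>n. e n * p ^ n) sums (A (p\<^sup>2) + p * B (p\<^sup>2))"
    and q: "norm q < 1" "q \<noteq> 0"
  shows "(\<lambda>n. e (2 * n) * q ^ n) sums A q" "(\<lambda>n. e (2 * n + 1) * q ^ n) sums B q"
proof -
  define p where "p = csqrt q"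
  have pq: "p\<^sup>2 = q" by (simp add: p_def)
  have p0: "p \<noteq> 0" using q by (simp add: p_def)
  have "norm p ^ 2 < 1" using q by (simp add: norm_power[symmetric] pq)
  then have p1: "norm p < 1" by (simp add: power_less_one_iff abs_square_less_1)
  have plus: "(\<lambda>n. e n * p ^ n) sums (A q + p * B q)"
    using sums[OF p1 p0] by (simp add: pq)
  have minus: "(\<lambda>n. e n * (- p) ^ n) sums (A q - p * B q)"
    using sums[of "- p"] p1 p0 by (simp add: pq)
  have "(\<lambda>n. (e n * p ^ n + e n * (- p) ^ n) / 2) sums ((A q + p * B q + (A q - p * B q)) / 2)"
    by (intro sums_divide sums_add plus minus)
  moreover have "strict_mono (\<lambda>n::nat. 2 * n)" by (simp add: strict_mono_def)
  moreover have "(e n * p ^ n + e n * (- p) ^ n) / 2 = 0" if "n \<notin> range (\<lambda>n. 2 * n)" for n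
  proof -
    have "odd n" using that by (auto elim: evenE)
    then show ?thesis by simp
  qed
  ultimately have "(\<lambda>n. (e (2 * n) * p ^ (2 * n) + e (2 * n) * (- p) ^ (2 * n)) / 2) sums A q"
    using sums_mono_reindex[of "\<lambda>n. 2 * n" "\<lambda>n. (e n * p ^ n + e n * (- p) ^ n) / 2"] by simp
  then have "(\<lambda>n. q ^ n * e (2 * n)) sums A q"
    by (simp add: power_mult pq)
  then show "(\<lambda>n. e (2 * n) * q ^ n) sums A q"
    by (simp only: mult.commute)
  have "(\<lambda>n. (e n * p ^ n - e n * (- p) ^ n) / 2) sums ((A q + p * B q - (A q - p * B q)) / 2)"
    by (intro sums_divide sums_diff plus minus)
  moreover have "strict_mono (\<lambda>n::nat. 2 * n + 1)" by (simp add: strict_mono_def)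
  moreover have "(e n * p ^ n - e n * (- p) ^ n) / 2 = 0" if "n \<notin> range (\<lambda>n. 2 * n + 1)" for n
  proof -
    have "even n" by (metis oddE rangeI that)
    then show ?thesis by simp
  qed
  ultimately have "(\<lambda>n. (e (2 * n + 1) * p ^ (2 * n + 1) - e (2 * n + 1) * (- p) ^ (2 * n + 1)) / 2) sums (p * B q)"
    using sums_mono_reindex[of "\<lambda>n. 2 * n + 1" "\<lambda>n. (e n * p ^ n - e n * (- p) ^ n) / 2"] by simp
  moreover have "(e (2 * n + 1) * p ^ (2 * n + 1) - e (2 * n + 1) * (- p) ^ (2 * n + 1)) / 2
      = p * (e (2 * n + 1) * q ^ n)" for n
  proof -
    have "p ^ (2 * n + 1) = p * q ^ n" "(- p) ^ (2 * n + 1) = - (p * q ^ n)"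
      by (simp_all add: power_mult pq)
    then show ?thesis by (simp only:) simp
  qed
  ultimately have "(\<lambda>n. p * (e (2 * n + 1) * q ^ n)) sums (p * B q)"
    by (simp only:)
  from sums_mult_D[OF this p0] p0 show "(\<lambda>n. e (2 * n + 1) * q ^ n) sums B q"
    by simp
qed

lemma rank_diff_sections:
  assumes q: "norm q < 1" "q \<noteq> 0"
  shows "(\<lambda>n. rank_diff_0_4 (8 * n + 1) * q ^ n) sums (J 2 q ^ 4 / (J 1 q ^ 2 * J 4 q))" (is ?A)
    "(\<lambda>n. rank_diff_0_4 (8 * n + 3) * q ^ n) sums (J 4 q ^ 3 / J 2 q ^ 2 + q * g (q ^ 2) (q ^ 4))" (is ?B)
    "(\<lambda>n. rank_diff_1_3 (8 * n) * q ^ n) sums (q * g q (q ^ 4))" (is ?C)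
    "(\<lambda>n. rank_diff_1_3 (8 * n + 2) * q ^ n) sums (J 2 q * J 4 q / J 1 q)" (is ?D)
proof -
  define F1 where "F1 = (\<lambda>q. J 2 q ^ 4 / (J 1 q ^ 2 * J 4 q))"
  define F3 where "F3 = (\<lambda>q. J 4 q ^ 3 / J 2 q ^ 2 + q * g (q ^ 2) (q ^ 4))"
  define F0 where "F0 = (\<lambda>q. q * g q (q ^ 4))"
  define F2 where "F2 = (\<lambda>q. J 2 q * J 4 q / J 1 q)"
  have p8: "p ^ 8 = ((p\<^sup>2)\<^sup>2)\<^sup>2" for p :: complex
    by (simp add: power_mult[symmetric])
  \<comment> \<open>Three bisections extract a class modulo 8. The zero summands put each series
    into the shape \<open>A (p^2) + p * B (p^2)\<close>, which is required at every stage.\<close>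
  have E: "(\<lambda>n. rank_diff_0_4 n * p ^ n) sums (0 + p * (F1 (((p\<^sup>2)\<^sup>2)\<^sup>2) + p\<^sup>2 * F3 (((p\<^sup>2)\<^sup>2)\<^sup>2)))"
    "(\<lambda>n. rank_diff_1_3 n * p ^ n) sums (F0 (((p\<^sup>2)\<^sup>2)\<^sup>2) + p\<^sup>2 * F2 (((p\<^sup>2)\<^sup>2)\<^sup>2) + p * 0)"
    if "norm p < 1" "p \<noteq> 0" for p
    using rank_diff_sums[OF that] unfolding p8 F1_def F3_def F0_def F2_def
    by (simp_all add: algebra_simps power3_eq_cube power2_eq_square)
  have O: "(\<lambda>n. rank_diff_0_4 (2 * n + 1) * p ^ n) sums (F1 ((p\<^sup>2)\<^sup>2) + p * F3 ((p\<^sup>2)\<^sup>2))"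
    if "norm p < 1" "p \<noteq> 0" for p
    by (rule bisect_sums(2)[where e = rank_diff_0_4 and A = "\<lambda>_. 0"
          and B = "\<lambda>p. F1 ((p\<^sup>2)\<^sup>2) + p * F3 ((p\<^sup>2)\<^sup>2)", OF E(1) that])
  have V: "(\<lambda>n. rank_diff_1_3 (2 * n) * p ^ n) sums (F0 ((p\<^sup>2)\<^sup>2) + p * F2 ((p\<^sup>2)\<^sup>2))"
    if "norm p < 1" "p \<noteq> 0" for p
    by (rule bisect_sums(1)[where e = rank_diff_1_3 and B = "\<lambda>_. 0"
          and A = "\<lambda>p. F0 ((p\<^sup>2)\<^sup>2) + p * F2 ((p\<^sup>2)\<^sup>2)", OF E(2) that])
  have O1: "(\<lambda>n. rank_diff_0_4 (2 * (2 * n) + 1) * p ^ n) sums (F1 (p\<^sup>2) + p * 0)"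
    and O3: "(\<lambda>n. rank_diff_0_4 (2 * (2 * n + 1) + 1) * p ^ n) sums (F3 (p\<^sup>2) + p * 0)"
    if "norm p < 1" "p \<noteq> 0" for p
    using bisect_sums[where e = "\<lambda>n. rank_diff_0_4 (2 * n + 1)" and A = "\<lambda>p. F1 (p\<^sup>2)"
          and B = "\<lambda>p. F3 (p\<^sup>2)", OF O that] by simp_all
  have V0: "(\<lambda>n. rank_diff_1_3 (2 * (2 * n)) * p ^ n) sums (F0 (p\<^sup>2) + p * 0)"
    and V2: "(\<lambda>n. rank_diff_1_3 (2 * (2 * n + 1)) * p ^ n) sums (F2 (p\<^sup>2) + p * 0)"
    if "norm p < 1" "p \<noteq> 0" for p
    using bisect_sums[where e = "\<lambda>n. rank_diff_1_3 (2 * n)" and A = "\<lambda>p. F0 (p\<^sup>2)"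
          and B = "\<lambda>p. F2 (p\<^sup>2)", OF V that] by simp_all
  note last = bisect_sums(1)[where B = "\<lambda>_. 0", OF _ q]
  have e: "2 * (2 * (2 * n)) + 1 = 8 * n + 1" "2 * (2 * (2 * n) + 1) + 1 = 8 * n + 3"
    "2 * (2 * (2 * n)) = 8 * n" "2 * (2 * (2 * n) + 1) = 8 * n + 2" for n :: nat
    by simp_all
  show ?A using last[of "\<lambda>n. rank_diff_0_4 (2 * (2 * n) + 1)" F1, OF O1] unfolding e(1) F1_def .
  show ?B using last[of "\<lambda>n. rank_diff_0_4 (2 * (2 * n + 1) + 1)" F3, OF O3] unfolding e(2) F3_def .
  show ?C using last[of "\<lambda>n. rank_diff_1_3 (2 * (2 * n))" F0, OF V0] unfolding e(3) F0_def .
  show ?D using last[of "\<lambda>n. rank_diff_1_3 (2 * (2 * n + 1))" F2, OF V2] unfolding e(4) F2_def .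
qed

section \<open>Constant terms, for q = 0\<close>

text \<open>A positive subscript contributes at least 4 to \<open>n\<close>, so only
  \<open>D = 0\<close> remains and all entries are 1; the symbol is then given by the length
  \<open>a\<close> of its top row.\<close>

lemma odd_Durfee_symbols_small:
  assumes "n \<le> 3"
  shows "odd_Durfee_symbols (Suc n) = (\<lambda>a. (0::nat, replicate a (1::nat), replicate (n - a) (1::nat))) ` {..n}"
proof (intro set_eqI iffI)
  fix S assume S: "S \<in> odd_Durfee_symbols (Suc n)"
  obtain D xs ys where Sd: "S = (D, xs, ys)" by (cases S)
  from S have n: "n = sum_list xs + sum_list ys + 2 * D\<^sup>2 + 2 * D"
    and rows: "\<And>x. x \<in> set xs \<union> set ys \<Longrightarrow> odd x \<and> x \<le> 2 * D + 1"
    by (auto simp: Sd odd_Durfee_symbols_def)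
  have D: "D = 0"
  proof (rule ccontr)
    assume "D \<noteq> 0"
    then have "D\<^sup>2 \<ge> 1" "D \<ge> 1" by auto
    with n assms show False by linarith
  qed
  have one: "x = 1" if "x \<in> set xs \<union> set ys" for x
    using rows[OF that] D by (auto elim!: oddE)
  define a b where "a = length xs" and "b = length ys"
  have xs: "xs = replicate a 1" and ys: "ys = replicate b 1"
    unfolding a_def b_def using one by (auto intro!: replicate_length_same[symmetric])
  have "n = a + b" using n by (simp add: xs ys D sum_list_replicate)
  then show "S \<in> (\<lambda>a. (0::nat, replicate a (1::nat), replicate (n - a) (1::nat))) ` {..n}"
    by (auto simp: Sd D xs ys)
next
  fix S assume "S \<in> (\<lambda>a. (0::nat, replicate a (1::nat), replicate (n - a) (1::nat))) ` {..n}"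
  then obtain a where a: "a \<le> n" "S = (0, replicate a 1, replicate (n - a) 1)" by auto
  have "sorted_wrt (\<ge>) (replicate m (1::nat))" for m
    by (induction m) auto
  with a show "S \<in> odd_Durfee_symbols (Suc n)"
    by (auto simp: odd_Durfee_symbols_def sum_list_replicate)
qed

lemma N0_small:
  assumes "n \<le> 3"
  shows "N0 c M (Suc n) = card {a \<in> {..n}. [2 * int a - int n = c] (mod M)}"
proof -
  let ?f = "\<lambda>a. (0::nat, replicate a (1::nat), replicate (n - a) (1::nat))"
  have "inj_on ?f A" for A
    by (auto simp: inj_on_def replicate_eq_replicate)
  moreover have "{S \<in> odd_Durfee_symbols (Suc n). [odd_rank S = c] (mod M)} =
      ?f ` {a \<in> {..n}. [2 * int a - int n = c] (mod M)}"
    unfolding odd_Durfee_symbols_small[OF assms] by (auto simp: of_nat_diff image_iff algebra_simps)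
  ultimately show ?thesis
    by (simp only: N0_def card_image)
qed

lemma rank_diff_initial:
  "rank_diff_0_4 1 = 1" "rank_diff_0_4 3 = 1" "rank_diff_1_3 0 = 0" "rank_diff_1_3 2 = 1"
proof -
  have small: "N0 c 8 (Suc n) = (\<Sum>a\<le>n. if [2 * int a - int n = c] (mod 8) then 1 else 0)" if "n \<le> 3" for c n
    unfolding N0_small[OF that] card_eq_sum by (rule sum.inter_filter) simp
  have "N0 0 8 1 = 1" "N0 4 8 1 = 0"
    using small[of 0 0] small[of 0 4] by (simp_all add: cong_def)
  moreover have "N0 1 8 2 = 1" "N0 3 8 2 = 0"
    using small[of 1 1] small[of 1 3] by (simp_all add: cong_def numeral_2_eq_2)
  moreover have "N0 0 8 3 = 1" "N0 4 8 3 = 0"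
    using small[of 2 0] small[of 2 4] by (simp_all add: cong_def numeral_2_eq_2 numeral_3_eq_3)
  ultimately show "rank_diff_0_4 1 = 1" "rank_diff_0_4 3 = 1" "rank_diff_1_3 0 = 0" "rank_diff_1_3 2 = 1"
    by (simp_all add: rank_diff_0_4_def rank_diff_1_3_def N0_zero)
qed

theorem theorem1p9:
  fixes q :: complex
  assumes "norm q < 1"
  shows
    "(\<lambda>n. of_int (int (N0 0 8 (8 * n + 1)) - int (N0 4 8 (8 * n + 1))) * q ^ n)
       sums (J 2 q ^ 4 / (J 1 q ^ 2 * J 4 q)) \<and>
     (\<lambda>n. of_int (int (N0 0 8 (8 * n + 3)) - int (N0 4 8 (8 * n + 3))) * q ^ n)
       sums (J 4 q ^ 3 / J 2 q ^ 2 + q * g (q ^ 2) (q ^ 4)) \<and>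
     (\<lambda>n. of_int (int (N0 1 8 (8 * n)) - int (N0 3 8 (8 * n))) * q ^ n)
       sums (q * g q (q ^ 4)) \<and>
     (\<lambda>n. of_int (int (N0 1 8 (8 * n + 2)) - int (N0 3 8 (8 * n + 2))) * q ^ n)
       sums (J 2 q * J 4 q / J 1 q)"
proof (cases "q = 0")
  case False
  then show ?thesis
    using rank_diff_sections[OF assms False] by (simp only: rank_diff_0_4_def rank_diff_1_3_def)
next
  case True
  \<comment> \<open>At the origin each claim reduces to its constant coefficient: the values of
    \<open>J\<close> become 1 and the terms with \<open>g\<close> carry a factor 0.\<close>
  have J: "J k 0 = 1" if "0 < k" for k
    using that by (simp add: J_def zero_power)
  have c: "(\<lambda>n. c n * 0 ^ n) sums v" if "c 0 = v" for c :: "nat \<Rightarrow> complex" and v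
    using powser_sums_zero[of c] that by simp
  show ?thesis
    unfolding True rank_diff_0_4_def[symmetric] rank_diff_1_3_def[symmetric]
    by (intro conjI c) (use rank_diff_initial in \<open>simp_all add: J numeral_2_eq_2\<close>)
qed

end
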